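(* Let $x\prec y$ be a binary relation (given by a formula of ZF$_\varepsilon$ with parameters) which is well founded in the realizability model $\mathcal{N}$, i.e. $\forall X(\forall x(\forall y(y\prec x\to y\not\varepsilon X)\to x\not\varepsilon X)\to\forall x(x\not\varepsilon X))$ holds in $\mathcal{N}$. Then for every formula $F[x,\vec z]$ of ZF$_\varepsilon$, the following holds in $\mathcal{N}$: $\forall\vec z\big(\forall x(\forall y(y\prec x\to F[y,\vec z])\to F[x,\vec z])\to\forall x\,F[x,\vec z]\big)$.
   Context: Classical realizability (Krivine): ground model $\mathcal{M}$ of ZF + V = L with a realizability algebra $(\Lambda,\Pi,\Lambda\star\Pi,\mathrm{QP},\perp\!\!\!\perp)$; $\mathcal{N}$ has the same individuals as $\mathcal{M}$; formulas of ZF$_\varepsilon$ (atomic $a\not\varepsilon b$, $a\notin b$, $a\subset b$, $\bot$; connectives $\to,\forall$; function symbols defined in $\mathcal{M}$) get truth values $\|F\|\subseteq\Pi$ with $\|a\not\varepsilon b\|=\{\pi:(a,\pi)\in b\}$, $\|F\to G\|=\{\xi\cdot\pi:\xi\Vdash F,\pi\in\|G\|\}$, $\|\forall xF\|=\bigcup_a\|F[a]\|$; $\xi\Vdash F$ iff $\xi\star\pi\in\perp\!\!\!\perp$ for all $\pi\in\|F\|$. A formula holds in $\mathcal{N}$ if realized by a proof-like term; $x\,\varepsilon\,y$ abbreviates $\neg(x\not\varepsilon y)$. (Equivalently, one may read the statement in a model $\mathcal{N}'$ of the theory of formulas holding in $\mathcal{N}$, which satisfies Krivine's theory ZF$_\varepsilon$.)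 *)

theory Defs
  imports Main
begin

section \<open>First-order set theory and the ground model\<close>

text \<open>
  Formulas of the language of ZF with parameters in \<open>'m\<close>, in de Bruijn notation:
  \<open>ZVar i\<close> refers to the \<open>i\<close>-th entry of the environment, and \<open>ZAll\<close> binds index 0.
\<close>

datatype 'm zarg = ZVar nat | ZPar 'm

datatype 'm zf =
    ZMem "'m zarg" "'m zarg"
  | ZEq "'m zarg" "'m zarg"
  | ZBot
  | ZImp "'m zf" "'m zf"
  | ZAll "'m zf"

primrec zarg_val :: "'m list \<Rightarrow> 'm zarg \<Rightarrow> 'm" where
  "zarg_val e (ZVar i) = e ! i"
| "zarg_val e (ZPar a) = a"

primrec zarg_below :: "nat \<Rightarrow> 'm zarg \<Rightarrow> bool" where
  "zarg_below n (ZVar i) \<longleftrightarrow> i < n"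
| "zarg_below n (ZPar a) \<longleftrightarrow> True"

primrec zf_below :: "nat \<Rightarrow> 'm zf \<Rightarrow> bool" where
  "zf_below n (ZMem s t) \<longleftrightarrow> zarg_below n s \<and> zarg_below n t"
| "zf_below n (ZEq s t) \<longleftrightarrow> zarg_below n s \<and> zarg_below n t"
| "zf_below n ZBot \<longleftrightarrow> True"
| "zf_below n (ZImp \<phi> \<psi>) \<longleftrightarrow> zf_below n \<phi> \<and> zf_below n \<psi>"
| "zf_below n (ZAll \<phi>) \<longleftrightarrow> zf_below (Suc n) \<phi>"

text \<open>
  The individuals of the model are the elements of the type \<open>'m\<close>. Every quantifier over sets in
  the definitions of this locale ranges over individuals, so that these definitions are the usual
  first-order ones, evaluated inside the model (which need not be well founded from outside).
\<close>

locale membership =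
  fixes E :: "'m \<Rightarrow> 'm \<Rightarrow> bool"  (infix "\<in>\<^sub>M" 50)
begin

primrec sat :: "'m list \<Rightarrow> 'm zf \<Rightarrow> bool" where
  "sat e (ZMem s t) \<longleftrightarrow> zarg_val e s \<in>\<^sub>M zarg_val e t"
| "sat e (ZEq s t) \<longleftrightarrow> zarg_val e s = zarg_val e t"
| "sat e ZBot \<longleftrightarrow> False"
| "sat e (ZImp \<phi> \<psi>) \<longleftrightarrow> (sat e \<phi> \<longrightarrow> sat e \<psi>)"
| "sat e (ZAll \<phi>) \<longleftrightarrow> (\<forall>a. sat (a # e) \<phi>)"

definition is_upair :: "'m \<Rightarrow> 'm \<Rightarrow> 'm \<Rightarrow> bool" where
  "is_upair p a b \<longleftrightarrow> (\<forall>z. z \<in>\<^sub>M p \<longleftrightarrow> z = a \<or> z = b)"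

definition is_pair :: "'m \<Rightarrow> 'm \<Rightarrow> 'm \<Rightarrow> bool" where
  "is_pair p a b \<longleftrightarrow> (\<forall>z. z \<in>\<^sub>M p \<longleftrightarrow> is_upair z a a \<or> is_upair z a b)"

definition pair_mem :: "'m \<Rightarrow> 'm \<Rightarrow> 'm \<Rightarrow> bool" where
  "pair_mem a b c \<longleftrightarrow> (\<exists>p. is_pair p a b \<and> p \<in>\<^sub>M c)"

definition is_empty :: "'m \<Rightarrow> bool" where
  "is_empty a \<longleftrightarrow> (\<forall>x. \<not> x \<in>\<^sub>M a)"

definition is_succ :: "'m \<Rightarrow> 'm \<Rightarrow> bool" where
  "is_succ s a \<longleftrightarrow> (\<forall>x. x \<in>\<^sub>M s \<longleftrightarrow> x \<in>\<^sub>M a \<or> x = a)"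

definition is_inductive :: "'m \<Rightarrow> bool" where
  "is_inductive w \<longleftrightarrow> (\<exists>z. is_empty z \<and> z \<in>\<^sub>M w) \<and>
     (\<forall>x. x \<in>\<^sub>M w \<longrightarrow> (\<exists>s. is_succ s x \<and> s \<in>\<^sub>M w))"

definition is_omega :: "'m \<Rightarrow> bool" where
  "is_omega w \<longleftrightarrow> is_inductive w \<and>
     (\<forall>v. is_inductive v \<longrightarrow> (\<forall>x. x \<in>\<^sub>M w \<longrightarrow> x \<in>\<^sub>M v))"

definition is_transitive :: "'m \<Rightarrow> bool" where
  "is_transitive a \<longleftrightarrow> (\<forall>x y. x \<in>\<^sub>M a \<and> y \<in>\<^sub>M x \<longrightarrow> y \<in>\<^sub>M a)"

definition is_ordinal :: "'m \<Rightarrow> bool" where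
  "is_ordinal a \<longleftrightarrow> is_transitive a \<and> (\<forall>x. x \<in>\<^sub>M a \<longrightarrow> is_transitive x)"

definition is_function :: "'m \<Rightarrow> 'm \<Rightarrow> 'm \<Rightarrow> bool" where
  "is_function f A B \<longleftrightarrow>
     (\<forall>p. p \<in>\<^sub>M f \<longrightarrow> (\<exists>x y. x \<in>\<^sub>M A \<and> y \<in>\<^sub>M B \<and> is_pair p x y)) \<and>
     (\<forall>x. x \<in>\<^sub>M A \<longrightarrow> (\<exists>!y. pair_mem x y f))"

subsection \<open>Constructible sets\<close>

definition agree_off :: "'m \<Rightarrow> 'm \<Rightarrow> 'm \<Rightarrow> 'm \<Rightarrow> bool" where
  "agree_off w i s t \<longleftrightarrow>
     (\<forall>j. j \<in>\<^sub>M w \<and> j \<noteq> i \<longrightarrow> (\<forall>x. pair_mem j x s \<longleftrightarrow> pair_mem j x t))"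

text \<open>
  Here \<open>w\<close> is \<open>\<omega>\<close>, and the elements of \<open>D\<close> are sets of assignments \<open>s : \<omega> \<rightarrow> A\<close>. The closure
  conditions are Tarski's clauses for \<open>v\<^sub>i \<in> v\<^sub>j\<close>, \<open>v\<^sub>i = v\<^sub>j\<close>, falsity, implication and \<open>\<forall>v\<^sub>i\<close>, so
  the least such \<open>D\<close> consists of the sets of assignments satisfying, in the structure \<open>(A, \<in>)\<close>,
  some formula in the sense of the model.
\<close>

definition tarski_closed :: "'m \<Rightarrow> 'm \<Rightarrow> 'm \<Rightarrow> bool" where
  "tarski_closed w A D \<longleftrightarrow>
     (\<forall>i j R. i \<in>\<^sub>M w \<and> j \<in>\<^sub>M w \<and>
        (\<forall>s. s \<in>\<^sub>M R \<longleftrightarrow> is_function s w A \<and>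
           (\<exists>x y. pair_mem i x s \<and> pair_mem j y s \<and> x \<in>\<^sub>M y)) \<longrightarrow> R \<in>\<^sub>M D) \<and>
     (\<forall>i j R. i \<in>\<^sub>M w \<and> j \<in>\<^sub>M w \<and>
        (\<forall>s. s \<in>\<^sub>M R \<longleftrightarrow> is_function s w A \<and>
           (\<exists>x. pair_mem i x s \<and> pair_mem j x s)) \<longrightarrow> R \<in>\<^sub>M D) \<and>
     (\<forall>R. is_empty R \<longrightarrow> R \<in>\<^sub>M D) \<and>
     (\<forall>Q R S. Q \<in>\<^sub>M D \<and> R \<in>\<^sub>M D \<and>
        (\<forall>s. s \<in>\<^sub>M S \<longleftrightarrow> is_function s w A \<and> (s \<in>\<^sub>M Q \<longrightarrow> s \<in>\<^sub>M R)) \<longrightarrow> S \<in>\<^sub>M D) \<and>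
     (\<forall>i Q R. i \<in>\<^sub>M w \<and> Q \<in>\<^sub>M D \<and>
        (\<forall>s. s \<in>\<^sub>M R \<longleftrightarrow> is_function s w A \<and>
           (\<forall>t. is_function t w A \<and> agree_off w i s t \<longrightarrow> t \<in>\<^sub>M Q)) \<longrightarrow> R \<in>\<^sub>M D)"

definition satisfaction_set :: "'m \<Rightarrow> 'm \<Rightarrow> 'm \<Rightarrow> bool" where
  "satisfaction_set w A R \<longleftrightarrow> (\<forall>D. tarski_closed w A D \<longrightarrow> R \<in>\<^sub>M D)"

text \<open>
  \<open>X \<in> Def(A)\<close>, the set of subsets of \<open>A\<close> definable over \<open>(A, \<in>)\<close> with parameters: the
  parameters are supplied by the assignment \<open>s\<close>, and the defining formula has its argument at
  variable \<open>i\<close>. The case of empty \<open>X\<close> is separate because there is no assignment when \<open>A\<close> is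
  empty, while \<open>Def(\<emptyset>) = {\<emptyset>}\<close>.
\<close>

definition definable_subset :: "'m \<Rightarrow> 'm \<Rightarrow> bool" where
  "definable_subset X A \<longleftrightarrow>
     is_empty X \<or>
     (\<exists>w R s i. is_omega w \<and> satisfaction_set w A R \<and> is_function s w A \<and> i \<in>\<^sub>M w \<and>
        (\<forall>x. x \<in>\<^sub>M X \<longleftrightarrow> x \<in>\<^sub>M A \<and>
           (\<exists>t. is_function t w A \<and> agree_off w i s t \<and> pair_mem i x t \<and> t \<in>\<^sub>M R)))"

text \<open>\<open>f\<close> is the sequence of the \<open>L\<^sub>\<beta> = \<Union>\<^sub>\<gamma>\<^sub><\<^sub>\<beta> Def(L\<^sub>\<gamma>)\<close> for \<open>\<beta> < \<alpha>\<close>.\<close>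

definition L_sequence :: "'m \<Rightarrow> 'm \<Rightarrow> bool" where
  "L_sequence f \<alpha> \<longleftrightarrow> is_ordinal \<alpha> \<and> (\<exists>B. is_function f \<alpha> B) \<and>
     (\<forall>\<beta> l. pair_mem \<beta> l f \<longrightarrow>
        (\<forall>y. y \<in>\<^sub>M l \<longleftrightarrow> (\<exists>\<gamma> k. \<gamma> \<in>\<^sub>M \<beta> \<and> pair_mem \<gamma> k f \<and> definable_subset y k)))"

definition constructible :: "'m \<Rightarrow> bool" where
  "constructible x \<longleftrightarrow> (\<exists>\<alpha> f \<beta> l. L_sequence f \<alpha> \<and> pair_mem \<beta> l f \<and> x \<in>\<^sub>M l)"

end

locale ground_model = membership E
  for E :: "'m \<Rightarrow> 'm \<Rightarrow> bool"  (infix "\<in>\<^sub>M" 50) +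
  assumes extensionality: "(\<forall>x. x \<in>\<^sub>M a \<longleftrightarrow> x \<in>\<^sub>M b) \<Longrightarrow> a = b"
    and foundation: "x \<in>\<^sub>M a \<Longrightarrow> \<exists>y. y \<in>\<^sub>M a \<and> (\<forall>z. z \<in>\<^sub>M y \<longrightarrow> \<not> z \<in>\<^sub>M a)"
    and pairing: "\<exists>p. \<forall>x. x \<in>\<^sub>M p \<longleftrightarrow> x = a \<or> x = b"
    and union: "\<exists>u. \<forall>x. x \<in>\<^sub>M u \<longleftrightarrow> (\<exists>y. x \<in>\<^sub>M y \<and> y \<in>\<^sub>M a)"
    and powerset: "\<exists>b. \<forall>x. x \<in>\<^sub>M b \<longleftrightarrow> (\<forall>y. y \<in>\<^sub>M x \<longrightarrow> y \<in>\<^sub>M a)"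
    and infinity: "\<exists>w. is_inductive w"
    and separation: "\<exists>b. \<forall>x. x \<in>\<^sub>M b \<longleftrightarrow> x \<in>\<^sub>M a \<and> sat (x # e) \<phi>"
    and replacement:
      "(\<And>x y y'. x \<in>\<^sub>M a \<Longrightarrow> sat (y # x # e) \<phi> \<Longrightarrow> sat (y' # x # e) \<phi> \<Longrightarrow> y = y')
        \<Longrightarrow> \<exists>b. \<forall>y. y \<in>\<^sub>M b \<longleftrightarrow> (\<exists>x. x \<in>\<^sub>M a \<and> sat (y # x # e) \<phi>)"
    and V_eq_L: "constructible x"


section \<open>Realizability algebras\<close>

record 'm realizability_algebra =
  terms :: 'm  stacks :: 'm  procs :: 'm  QP :: 'm  pole :: 'm
  app :: "'m \<Rightarrow> 'm \<Rightarrow> 'm"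
  push :: "'m \<Rightarrow> 'm \<Rightarrow> 'm"
  process :: "'m \<Rightarrow> 'm \<Rightarrow> 'm"
  cont :: "'m \<Rightarrow> 'm"
  comb_B :: 'm  comb_C :: 'm  comb_I :: 'm  comb_K :: 'm  comb_W :: 'm  comb_cc :: 'm

context membership
begin

text \<open>
  The restriction of the operation \<open>f\<close> to \<open>A \<times> B\<close> (respectively \<open>A\<close>) is an individual of the
  model, with values in \<open>C\<close>.
\<close>

definition binary_op :: "('m \<Rightarrow> 'm \<Rightarrow> 'm) \<Rightarrow> 'm \<Rightarrow> 'm \<Rightarrow> 'm \<Rightarrow> bool" where
  "binary_op f A B C \<longleftrightarrow>
     (\<forall>x y. x \<in>\<^sub>M A \<and> y \<in>\<^sub>M B \<longrightarrow> f x y \<in>\<^sub>M C) \<and>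
     (\<exists>g. \<forall>p. p \<in>\<^sub>M g \<longleftrightarrow>
        (\<exists>x y q. x \<in>\<^sub>M A \<and> y \<in>\<^sub>M B \<and> is_pair q x y \<and> is_pair p q (f x y)))"

definition unary_op :: "('m \<Rightarrow> 'm) \<Rightarrow> 'm \<Rightarrow> 'm \<Rightarrow> bool" where
  "unary_op f A C \<longleftrightarrow>
     (\<forall>x. x \<in>\<^sub>M A \<longrightarrow> f x \<in>\<^sub>M C) \<and>
     (\<exists>g. \<forall>p. p \<in>\<^sub>M g \<longleftrightarrow> (\<exists>x. x \<in>\<^sub>M A \<and> is_pair p x (f x)))"

end

text \<open>
  The reduction rules are stated as closure of the pole under anti-reduction. Nothing is assumed
  about the pole beyond them, so \<open>\<bottom>\<close> may be realized by a proof-like term.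
\<close>

locale realizability_model = ground_model E
  for E :: "'m \<Rightarrow> 'm \<Rightarrow> bool"  (infix "\<in>\<^sub>M" 50) +
  fixes A :: "'m realizability_algebra"
  assumes app_op: "binary_op (app A) (terms A) (terms A) (terms A)"
    and push_op: "binary_op (push A) (terms A) (stacks A) (stacks A)"
    and process_op: "binary_op (process A) (terms A) (stacks A) (procs A)"
    and cont_op: "unary_op (cont A) (stacks A) (terms A)"
    and QP_terms: "\<theta> \<in>\<^sub>M QP A \<Longrightarrow> \<theta> \<in>\<^sub>M terms A"
    and QP_combinators:
      "\<theta> \<in> {comb_B A, comb_C A, comb_I A, comb_K A, comb_W A, comb_cc A} \<Longrightarrow> \<theta> \<in>\<^sub>M QP A"
    and QP_app: "\<lbrakk>\<theta> \<in>\<^sub>M QP A; \<theta>' \<in>\<^sub>M QP A\<rbrakk> \<Longrightarrow> app A \<theta> \<theta>' \<in>\<^sub>M QP A"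
    and pole_procs: "p \<in>\<^sub>M pole A \<Longrightarrow> p \<in>\<^sub>M procs A"
    and pole_app: "\<lbrakk>\<xi> \<in>\<^sub>M terms A; \<eta> \<in>\<^sub>M terms A; \<pi> \<in>\<^sub>M stacks A;
        process A \<xi> (push A \<eta> \<pi>) \<in>\<^sub>M pole A\<rbrakk>
      \<Longrightarrow> process A (app A \<xi> \<eta>) \<pi> \<in>\<^sub>M pole A"
    and pole_I: "\<lbrakk>\<xi> \<in>\<^sub>M terms A; \<pi> \<in>\<^sub>M stacks A; process A \<xi> \<pi> \<in>\<^sub>M pole A\<rbrakk>
      \<Longrightarrow> process A (comb_I A) (push A \<xi> \<pi>) \<in>\<^sub>M pole A"
    and pole_K: "\<lbrakk>\<xi> \<in>\<^sub>M terms A; \<eta> \<in>\<^sub>M terms A; \<pi> \<in>\<^sub>M stacks A; process A \<xi> \<pi> \<in>\<^sub>M pole A\<rbrakk>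
      \<Longrightarrow> process A (comb_K A) (push A \<xi> (push A \<eta> \<pi>)) \<in>\<^sub>M pole A"
    and pole_W: "\<lbrakk>\<xi> \<in>\<^sub>M terms A; \<eta> \<in>\<^sub>M terms A; \<pi> \<in>\<^sub>M stacks A;
        process A \<xi> (push A \<eta> (push A \<eta> \<pi>)) \<in>\<^sub>M pole A\<rbrakk>
      \<Longrightarrow> process A (comb_W A) (push A \<xi> (push A \<eta> \<pi>)) \<in>\<^sub>M pole A"
    and pole_C: "\<lbrakk>\<xi> \<in>\<^sub>M terms A; \<eta> \<in>\<^sub>M terms A; \<zeta> \<in>\<^sub>M terms A; \<pi> \<in>\<^sub>M stacks A;
        process A \<xi> (push A \<zeta> (push A \<eta> \<pi>)) \<in>\<^sub>M pole A\<rbrakk>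
      \<Longrightarrow> process A (comb_C A) (push A \<xi> (push A \<eta> (push A \<zeta> \<pi>))) \<in>\<^sub>M pole A"
    and pole_B: "\<lbrakk>\<xi> \<in>\<^sub>M terms A; \<eta> \<in>\<^sub>M terms A; \<zeta> \<in>\<^sub>M terms A; \<pi> \<in>\<^sub>M stacks A;
        process A \<xi> (push A (app A \<eta> \<zeta>) \<pi>) \<in>\<^sub>M pole A\<rbrakk>
      \<Longrightarrow> process A (comb_B A) (push A \<xi> (push A \<eta> (push A \<zeta> \<pi>))) \<in>\<^sub>M pole A"
    and pole_cc: "\<lbrakk>\<xi> \<in>\<^sub>M terms A; \<pi> \<in>\<^sub>M stacks A;
        process A \<xi> (push A (cont A \<pi>) \<pi>) \<in>\<^sub>M pole A\<rbrakk>
      \<Longrightarrow> process A (comb_cc A) (push A \<xi> \<pi>) \<in>\<^sub>M pole A"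
    and pole_cont: "\<lbrakk>\<xi> \<in>\<^sub>M terms A; \<pi> \<in>\<^sub>M stacks A; \<pi>' \<in>\<^sub>M stacks A;
        process A \<xi> \<pi> \<in>\<^sub>M pole A\<rbrakk>
      \<Longrightarrow> process A (cont A \<pi>) (push A \<xi> \<pi>') \<in>\<^sub>M pole A"


section \<open>Formulas of \<open>ZF\<^sub>\<epsilon>\<close>\<close>

text \<open>
  Again de Bruijn notation with parameters. In \<open>Fun \<phi> ts\<close> the formula \<open>\<phi>\<close> is the definition in the
  ground model of a function symbol of arity \<open>length ts\<close>: index 0 is the value, and the following
  indices are the arguments.
\<close>

datatype 'm trm = Var nat | Par 'm | Fun "'m zf" "'m trm list"

datatype 'm fm =
    NotEps "'m trm" "'m trm"
  | NotIn "'m trm" "'m trm"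
  | Sub "'m trm" "'m trm"
  | Bot
  | Imp "'m fm" "'m fm"
  | All "'m fm"

primrec ren_trm :: "(nat \<Rightarrow> nat) \<Rightarrow> 'm trm \<Rightarrow> 'm trm" where
  "ren_trm r (Var i) = Var (r i)"
| "ren_trm r (Par a) = Par a"
| "ren_trm r (Fun \<phi> ts) = Fun \<phi> (map (ren_trm r) ts)"

primrec ren :: "(nat \<Rightarrow> nat) \<Rightarrow> 'm fm \<Rightarrow> 'm fm" where
  "ren r (NotEps s t) = NotEps (ren_trm r s) (ren_trm r t)"
| "ren r (NotIn s t) = NotIn (ren_trm r s) (ren_trm r t)"
| "ren r (Sub s t) = Sub (ren_trm r s) (ren_trm r t)"
| "ren r Bot = Bot"
| "ren r (Imp F G) = Imp (ren r F) (ren r G)"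
| "ren r (All F) = All (ren (case_nat 0 (\<lambda>i. Suc (r i))) F)"

context membership
begin

primrec trm_val :: "'m list \<Rightarrow> 'm trm \<Rightarrow> 'm" where
  "trm_val e (Var i) = e ! i"
| "trm_val e (Par a) = a"
| "trm_val e (Fun \<phi> ts) = (THE y. sat (y # map (trm_val e) ts) \<phi>)"

text \<open>Well-formedness: variables are below \<open>n\<close>, and function symbols are total on the model.\<close>

fun wf_trm :: "nat \<Rightarrow> 'm trm \<Rightarrow> bool" where
  "wf_trm n (Var i) \<longleftrightarrow> i < n"
| "wf_trm n (Par a) \<longleftrightarrow> True"
| "wf_trm n (Fun \<phi> ts) \<longleftrightarrow> zf_below (Suc (length ts)) \<phi> \<and>
     (\<forall>as. length as = length ts \<longrightarrow> (\<exists>!y. sat (y # as) \<phi>)) \<and> (\<forall>t\<in>set ts. wf_trm n t)"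

primrec wf_fm :: "nat \<Rightarrow> 'm fm \<Rightarrow> bool" where
  "wf_fm n (NotEps s t) \<longleftrightarrow> wf_trm n s \<and> wf_trm n t"
| "wf_fm n (NotIn s t) \<longleftrightarrow> wf_trm n s \<and> wf_trm n t"
| "wf_fm n (Sub s t) \<longleftrightarrow> wf_trm n s \<and> wf_trm n t"
| "wf_fm n Bot \<longleftrightarrow> True"
| "wf_fm n (Imp F G) \<longleftrightarrow> wf_fm n F \<and> wf_fm n G"
| "wf_fm n (All F) \<longleftrightarrow> wf_fm (Suc n) F"

end


section \<open>Truth values and realizability\<close>

context realizability_model
begin

definition orth :: "'m set \<Rightarrow> 'm set" where
  "orth X = {\<xi>. \<xi> \<in>\<^sub>M terms A \<and> (\<forall>\<pi>\<in>X. process A \<xi> \<pi> \<in>\<^sub>M pole A)}"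

definition row :: "'m \<Rightarrow> 'm \<Rightarrow> 'm \<Rightarrow> 'm set" where
  "row S a b = {\<pi>. \<pi> \<in>\<^sub>M stacks A \<and> (\<exists>q. is_pair q a b \<and> pair_mem q \<pi> S)}"

text \<open>
  The truth values of \<open>a \<subset> b\<close> and \<open>a \<notin> b\<close> are given in the ground model by the simultaneous
  recursion
  \<open>\<parallel>a \<subset> b\<parallel> = \<Union>\<^sub>c {\<xi> \<cdot> \<pi> | (c,\<pi>) \<in> a, \<xi> \<tturnstile> c \<notin> b}\<close> and
  \<open>\<parallel>a \<notin> b\<parallel> = \<Union>\<^sub>c {\<xi> \<cdot> \<xi>' \<cdot> \<pi> | (c,\<pi>) \<in> b, \<xi> \<tturnstile> a \<subset> c, \<xi>' \<tturnstile> c \<subset> a}\<close>.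
  Since the model need not be well founded from outside, the recursion is carried out inside it:
  \<open>S\<close> and \<open>N\<close> are individuals, namely sets of triples tabulating the two truth values for \<open>a\<close>, \<open>b\<close>
  in a transitive set \<open>T\<close>. By the recursion theorem in the ground model, such tables exist for
  every transitive \<open>T\<close>, and they agree wherever they overlap.
\<close>

definition atomic_tables :: "'m \<Rightarrow> 'm \<Rightarrow> 'm \<Rightarrow> bool" where
  "atomic_tables T S N \<longleftrightarrow> is_transitive T \<and>
     (\<forall>a b. a \<in>\<^sub>M T \<and> b \<in>\<^sub>M T \<longrightarrow>
        row S a b = {push A \<xi> \<pi> | \<xi> \<pi> c.
            \<pi> \<in>\<^sub>M stacks A \<and> pair_mem c \<pi> a \<and> \<xi> \<in> orth (row N c b)} \<and>
        row N a b = {push A \<xi> (push A \<xi>' \<pi>) | \<xi> \<xi>' \<pi> c.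
            \<pi> \<in>\<^sub>M stacks A \<and> pair_mem c \<pi> b \<and>
            \<xi> \<in> orth (row S a c) \<and> \<xi>' \<in> orth (row S c a)})"

definition sub_val :: "'m \<Rightarrow> 'm \<Rightarrow> 'm set" where
  "sub_val a b = {\<pi>. \<exists>T S N. atomic_tables T S N \<and> a \<in>\<^sub>M T \<and> b \<in>\<^sub>M T \<and> \<pi> \<in> row S a b}"

definition notin_val :: "'m \<Rightarrow> 'm \<Rightarrow> 'm set" where
  "notin_val a b = {\<pi>. \<exists>T S N. atomic_tables T S N \<and> a \<in>\<^sub>M T \<and> b \<in>\<^sub>M T \<and> \<pi> \<in> row N a b}"

primrec truth_val :: "'m list \<Rightarrow> 'm fm \<Rightarrow> 'm set" where
  "truth_val e (NotEps s t) =
     {\<pi>. \<pi> \<in>\<^sub>M stacks A \<and> pair_mem (trm_val e s) \<pi> (trm_val e t)}"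
| "truth_val e (NotIn s t) = notin_val (trm_val e s) (trm_val e t)"
| "truth_val e (Sub s t) = sub_val (trm_val e s) (trm_val e t)"
| "truth_val e Bot = {\<pi>. \<pi> \<in>\<^sub>M stacks A}"
| "truth_val e (Imp F G) = {push A \<xi> \<pi> | \<xi> \<pi>. \<xi> \<in> orth (truth_val e F) \<and> \<pi> \<in> truth_val e G}"
| "truth_val e (All F) = (\<Union>a. truth_val (a # e) F)"

definition realizes :: "'m \<Rightarrow> 'm fm \<Rightarrow> bool" where
  "realizes \<xi> F \<longleftrightarrow> \<xi> \<in> orth (truth_val [] F)"

definition holds :: "'m fm \<Rightarrow> bool" where
  "holds F \<longleftrightarrow> (\<exists>\<theta>. \<theta> \<in>\<^sub>M QP A \<and> realizes \<theta> F)"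

end


section \<open>Well-foundedness and the induction scheme\<close>

text \<open>
  The formula \<open>P\<close> expresses \<open>y \<prec> x\<close> with \<open>y\<close> at index 0 and \<open>x\<close> at index 1.

  \<open>\<forall>X (\<forall>x (\<forall>y (y \<prec> x \<rightarrow> y \<notin>\<^sub>\<epsilon> X) \<rightarrow> x \<notin>\<^sub>\<epsilon> X) \<rightarrow> \<forall>x (x \<notin>\<^sub>\<epsilon> X))\<close>, where \<open>\<notin>\<^sub>\<epsilon>\<close> is \<open>NotEps\<close>:
\<close>

definition well_founded_fm :: "'m fm \<Rightarrow> 'm fm" where
  "well_founded_fm P =
     All (Imp (All (Imp (All (Imp P (NotEps (Var 0) (Var 2)))) (NotEps (Var 0) (Var 1))))
              (All (NotEps (Var 0) (Var 1))))"

text \<open>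
  In \<open>F[x, z\<^sub>1, \<dots>, z\<^sub>n]\<close> the variable \<open>x\<close> is at index 0. Under the quantifier \<open>\<forall>y\<close> the index of \<open>y\<close> is
  0 and that of \<open>x\<close> is 1, so \<open>F[y, z]\<close> is obtained by keeping index 0 and shifting the others.
\<close>

definition induction_fm :: "'m fm \<Rightarrow> 'm fm \<Rightarrow> 'm fm" where
  "induction_fm P F =
     Imp (All (Imp (All (Imp P (ren (case_nat 0 (\<lambda>j. Suc (Suc j))) F))) F)) (All F)"

end

theory Submission
  imports Defs
begin

text \<open>
  Every realizer of well-foundedness realizes induction. Fix \<open>a\<close> and the parameters \<open>z\<close>. Truth
  values are definable in the ground model, so collection there gives a set \<open>T\<close> containing \<open>a\<close>
  such that, for \<open>x\<close> in \<open>T\<close>, every stack in \<open>\<parallel>\<forall>y (y \<prec> x \<rightarrow> F[y])\<parallel>\<close> already comes from some \<open>y\<close>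
  in \<open>T\<close>. Let \<open>X\<close> be the set of the pairs \<open>(x, \<pi>)\<close> with \<open>x\<close> in \<open>T\<close> and \<open>\<pi>\<close> in \<open>\<parallel>F[x]\<parallel>\<close>. Then
  \<open>\<parallel>x \<notin>\<^sub>\<epsilon> X\<parallel>\<close> is \<open>\<parallel>F[x]\<parallel>\<close> on \<open>T\<close> and empty elsewhere. Hence the premise of well-foundedness for
  \<open>X\<close> has a smaller truth value than the premise of induction, while \<open>\<parallel>F[a]\<parallel> = \<parallel>a \<notin>\<^sub>\<epsilon> X\<parallel>\<close>.
\<close>

section \<open>Definable relations\<close>

context membership
begin

text \<open>
  Relations are taken on environments: a quantified variable becomes \<open>hd e\<close>, and the outer
  variables are accessed through \<open>tl e\<close>. Short environments are ignored since
  \<open>e ! i\<close> is unspecified there.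
\<close>

definition fo_arg :: "('m list \<Rightarrow> 'm) \<Rightarrow> bool" where
  "fo_arg f \<longleftrightarrow> (\<exists>t N. \<forall>e. N \<le> length e \<longrightarrow> zarg_val e t = f e)"

definition fo_rel :: "('m list \<Rightarrow> bool) \<Rightarrow> bool" where
  "fo_rel R \<longleftrightarrow> (\<exists>\<phi> N. \<forall>e. N \<le> length e \<longrightarrow> sat e \<phi> = R e)"

section \<open>Closure of definable relations under first-order logic\<close>

lemma fo_arg_const: "fo_arg (\<lambda>e. c)"
  unfolding fo_arg_def by (rule exI[of _ "ZPar c"]) simp

lemma fo_arg_hd: "fo_arg hd"
  unfolding fo_arg_def
  by (rule exI[of _ "ZVar 0"], rule exI[of _ 1]) (auto simp: Suc_le_length_iff)

lemma fo_arg_tl: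
  assumes "fo_arg f"
  shows "fo_arg (\<lambda>e. f (tl e))"
proof -
  obtain t N where t: "\<And>e. N \<le> length e \<Longrightarrow> zarg_val e t = f e"
    using assms unfolding fo_arg_def by blast
  show ?thesis
  proof (cases t)
    case (ZVar i)
    show ?thesis unfolding fo_arg_def
    proof (intro exI allI impI)
      fix e :: "'m list" assume "Suc (N + i) \<le> length e"
      then show "zarg_val e (ZVar (Suc i)) = f (tl e)"
        using t[of "tl e"] ZVar by (cases e) auto
    qed
  next
    case (ZPar a)
    show ?thesis unfolding fo_arg_def
    proof (intro exI allI impI)
      fix e :: "'m list" assume "Suc N \<le> length e"
      then show "zarg_val e (ZPar a) = f (tl e)"
        using t[of "tl e"] ZPar by (cases e) auto
    qed
  qed
qed

lemmas fo_args = fo_arg_const fo_arg_hd fo_arg_tl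

lemma fo_atom:
  assumes "fo_arg f" "fo_arg g"
  shows fo_mem: "fo_rel (\<lambda>e. f e \<in>\<^sub>M g e)" and fo_eq: "fo_rel (\<lambda>e. f e = g e)"
proof -
  obtain s N where s: "\<And>e. N \<le> length e \<Longrightarrow> zarg_val e s = f e"
    using assms(1) unfolding fo_arg_def by blast
  obtain t K where t: "\<And>e. K \<le> length e \<Longrightarrow> zarg_val e t = g e"
    using assms(2) unfolding fo_arg_def by blast
  show "fo_rel (\<lambda>e. f e \<in>\<^sub>M g e)" unfolding fo_rel_def
    by (rule exI[of _ "ZMem s t"], rule exI[of _ "max N K"]) (auto simp: s t)
  show "fo_rel (\<lambda>e. f e = g e)" unfolding fo_rel_def
    by (rule exI[of _ "ZEq s t"], rule exI[of _ "max N K"]) (auto simp: s t)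
qed

text \<open>However it is described outside the model, \<open>c\<close> does not depend on the
  environment, so verum or falsum defines it.\<close>

lemma fo_const: "fo_rel (\<lambda>e. c)"
proof (cases c)
  case True
  then show ?thesis unfolding fo_rel_def
    by (intro exI[of _ "ZImp ZBot ZBot"]) auto
next
  case False
  then show ?thesis unfolding fo_rel_def
    by (intro exI[of _ "ZBot"]) auto
qed

lemma fo_imp:
  assumes "fo_rel R" "fo_rel S"
  shows "fo_rel (\<lambda>e. R e \<longrightarrow> S e)"
proof -
  obtain \<phi> N where 1: "\<And>e. N \<le> length e \<Longrightarrow> sat e \<phi> = R e"
    using assms(1) unfolding fo_rel_def by blast
  obtain \<psi> K where 2: "\<And>e. K \<le> length e \<Longrightarrow> sat e \<psi> = S e"
    using assms(2) unfolding fo_rel_def by blast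
  show ?thesis unfolding fo_rel_def
    by (rule exI[of _ "ZImp \<phi> \<psi>"], rule exI[of _ "max N K"]) (auto simp: 1 2)
qed

lemma fo_all:
  assumes "fo_rel (\<lambda>e. R (hd e) (tl e))"
  shows "fo_rel (\<lambda>e. \<forall>x. R x e)"
proof -
  obtain \<phi> N where "\<And>e. N \<le> length e \<Longrightarrow> sat e \<phi> = R (hd e) (tl e)"
    using assms unfolding fo_rel_def by blast
  then have "\<And>x e. N \<le> length e \<Longrightarrow> sat (x # e) \<phi> = R x e"
    by simp
  then show ?thesis unfolding fo_rel_def
    by (intro exI[of _ "ZAll \<phi>"] exI[of _ N]) auto
qed

lemma fo_not: "fo_rel R \<Longrightarrow> fo_rel (\<lambda>e. \<not> R e)"
  using fo_imp[OF _ fo_const[of False]] by simp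

lemma fo_conj: "fo_rel R \<Longrightarrow> fo_rel S \<Longrightarrow> fo_rel (\<lambda>e. R e \<and> S e)"
  using fo_not[OF fo_imp[OF _ fo_not]] by simp

lemma fo_disj: "fo_rel R \<Longrightarrow> fo_rel S \<Longrightarrow> fo_rel (\<lambda>e. R e \<or> S e)"
  using fo_imp[OF fo_not[of R]] by (simp add: disj_imp)

lemma fo_iff: "fo_rel R \<Longrightarrow> fo_rel S \<Longrightarrow> fo_rel (\<lambda>e. R e \<longleftrightarrow> S e)"
  using fo_conj[OF fo_imp fo_imp, of R S S R] by (simp add: iff_conv_conj_imp)

lemma fo_ex: "fo_rel (\<lambda>e. R (hd e) (tl e)) \<Longrightarrow> fo_rel (\<lambda>e. \<exists>x. R x e)"
  using fo_not[OF fo_all[of "\<lambda>x e. \<not> R x e", OF fo_not]] by simp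

lemmas fo_logic = fo_mem fo_eq fo_const fo_imp fo_not fo_conj fo_disj fo_iff fo_all fo_ex

section \<open>Definability of the notions behind the constructible hierarchy\<close>

lemma fo_upair:
  assumes "fo_arg p" "fo_arg a" "fo_arg b"
  shows "fo_rel (\<lambda>e. is_upair (p e) (a e) (b e))"
  unfolding is_upair_def by (intro fo_logic fo_args assms)

lemma fo_pair:
  assumes "fo_arg p" "fo_arg a" "fo_arg b"
  shows "fo_rel (\<lambda>e. is_pair (p e) (a e) (b e))"
  unfolding is_pair_def by (intro fo_logic fo_upair fo_args assms)

lemma fo_pair_mem:
  assumes "fo_arg a" "fo_arg b" "fo_arg c"
  shows "fo_rel (\<lambda>e. pair_mem (a e) (b e) (c e))"
  unfolding pair_mem_def by (intro fo_logic fo_pair fo_args assms)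

lemma fo_empty: "fo_arg a \<Longrightarrow> fo_rel (\<lambda>e. is_empty (a e))"
  unfolding is_empty_def by (intro fo_logic fo_args)

lemma fo_succ: "fo_arg s \<Longrightarrow> fo_arg a \<Longrightarrow> fo_rel (\<lambda>e. is_succ (s e) (a e))"
  unfolding is_succ_def by (intro fo_logic fo_args)

lemma fo_inductive: "fo_arg w \<Longrightarrow> fo_rel (\<lambda>e. is_inductive (w e))"
  unfolding is_inductive_def by (intro fo_logic fo_empty fo_succ fo_args)

lemma fo_omega: "fo_arg w \<Longrightarrow> fo_rel (\<lambda>e. is_omega (w e))"
  unfolding is_omega_def by (intro fo_logic fo_inductive fo_args)

lemma fo_transitive: "fo_arg a \<Longrightarrow> fo_rel (\<lambda>e. is_transitive (a e))"
  unfolding is_transitive_def by (intro fo_logic fo_args)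

lemma fo_ordinal: "fo_arg a \<Longrightarrow> fo_rel (\<lambda>e. is_ordinal (a e))"
  unfolding is_ordinal_def by (intro fo_logic fo_transitive fo_args)

lemma fo_function:
  assumes "fo_arg f" "fo_arg a" "fo_arg b"
  shows "fo_rel (\<lambda>e. is_function (f e) (a e) (b e))"
  unfolding is_function_def Ex1_def
  by (intro fo_logic fo_pair fo_pair_mem fo_args assms)

lemma fo_agree_off:
  assumes "fo_arg w" "fo_arg i" "fo_arg s" "fo_arg t"
  shows "fo_rel (\<lambda>e. agree_off (w e) (i e) (s e) (t e))"
  unfolding agree_off_def by (intro fo_logic fo_pair_mem fo_args assms)

lemma fo_tarski_closed:
  assumes "fo_arg w" "fo_arg a" "fo_arg d"
  shows "fo_rel (\<lambda>e. tarski_closed (w e) (a e) (d e))"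
  unfolding tarski_closed_def
  by (intro fo_logic fo_pair_mem fo_function fo_agree_off fo_empty fo_args assms)

lemma fo_satisfaction_set:
  assumes "fo_arg w" "fo_arg a" "fo_arg r"
  shows "fo_rel (\<lambda>e. satisfaction_set (w e) (a e) (r e))"
  unfolding satisfaction_set_def by (intro fo_logic fo_tarski_closed fo_args assms)

lemma fo_definable_subset:
  assumes "fo_arg x" "fo_arg a"
  shows "fo_rel (\<lambda>e. definable_subset (x e) (a e))"
  unfolding definable_subset_def
  by (intro fo_logic fo_empty fo_omega fo_satisfaction_set fo_function fo_agree_off fo_pair_mem
      fo_args assms)

lemma fo_L_sequence:
  assumes "fo_arg f" "fo_arg a"
  shows "fo_rel (\<lambda>e. L_sequence (f e) (a e))"
  unfolding L_sequence_def
  by (intro fo_logic fo_ordinal fo_function fo_pair_mem fo_definable_subset fo_args assms)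

text \<open>The relation "\<open>l\<close> is the level L_\<beta>", read off from any sequence that
  reaches \<beta>. It is kept as a relation so that it stays first-order;
  \<open>L_level_unique\<close> supplies functionality.\<close>

definition L_level :: "'m \<Rightarrow> 'm \<Rightarrow> bool" where
  "L_level \<beta> l \<longleftrightarrow> (\<exists>f \<alpha>. L_sequence f \<alpha> \<and> pair_mem \<beta> l f)"

lemma fo_L_level: "fo_arg b \<Longrightarrow> fo_arg l \<Longrightarrow> fo_rel (\<lambda>e. L_level (b e) (l e))"
  unfolding L_level_def by (intro fo_logic fo_L_sequence fo_pair_mem fo_args)

text \<open>Substitution of admissible arguments for the variables of a fixed formula. Below a
  quantifier the bound variable enters the list as \<open>hd\<close> and the old arguments are
  composed with \<open>tl\<close>; \<open>zf_below\<close> keeps every lookup inside the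
  list.\<close>

lemma fo_sat:
  assumes "zf_below (length gs) \<phi>" "list_all fo_arg gs"
  shows "fo_rel (\<lambda>e. sat (map (\<lambda>g. g e) gs) \<phi>)"
proof -
  have arg: "fo_arg (\<lambda>e. zarg_val (map (\<lambda>g. g e) gs) t)"
    if "zarg_below (length gs) t" "list_all fo_arg gs" for t and gs :: "('m list \<Rightarrow> 'm) list"
    using that by (cases t) (auto simp: list_all_length fo_arg_const)
  show ?thesis using assms
  proof (induction \<phi> arbitrary: gs)
    case (ZAll \<phi>)
    let ?gs = "hd # map (\<lambda>g e. g (tl e)) gs"
    have "list_all fo_arg ?gs"
      using ZAll.prems(2) by (auto simp: list_all_iff fo_args)
    then have "fo_rel (\<lambda>e. sat (map (\<lambda>g. g e) ?gs) \<phi>)"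
      using ZAll.prems(1) by (intro ZAll.IH) auto
    then have "fo_rel (\<lambda>e. sat (hd e # map (\<lambda>g. g (tl e)) gs) \<phi>)"
      by (simp add: comp_def)
    from fo_all[of "\<lambda>x e. sat (x # map (\<lambda>g. g e) gs) \<phi>", OF this] show ?case by simp
  qed (auto intro!: fo_logic arg)
qed

text \<open>Admissible arguments are only variables and parameters, so the value of a term is
  handled through its graph.\<close>

lemma fo_trm_val:
  assumes "wf_trm (length gs) t" "list_all fo_arg gs" "fo_arg f"
  shows "fo_rel (\<lambda>e. f e = trm_val (map (\<lambda>g. g e) gs) t)"
  using assms
proof (induction t arbitrary: gs f)
  case (Var i)
  then show ?case by (auto simp: list_all_length intro!: fo_eq)
next
  case (Par a)
  then show ?case by (auto intro!: fo_logic fo_args)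
next
  case (Fun \<phi> ts)
  \<comment> \<open>\<open>hs\<close> lists the arguments that are already variables or parameters,
    \<open>us\<close> those that are still terms. Each round names the value of the first term by an
    existential quantifier and moves it to the end of \<open>hs\<close>.\<close>
  have *: "fo_rel (\<lambda>e. sat (map (\<lambda>h. h e) hs @ map (trm_val (map (\<lambda>g. g e) gs)) us) \<phi>)"
    if "set us \<subseteq> set ts" "list_all fo_arg gs" "list_all fo_arg hs" "\<forall>u\<in>set us. wf_trm (length gs) u"
      "zf_below (length hs + length us) \<phi>"
    for us hs gs
    using that
  proof (induction us arbitrary: hs gs)
    case Nil
    then show ?case using fo_sat[of hs \<phi>] by simp
  next
    case (Cons u us)
    let ?up = "map (\<lambda>g e. g (tl e))"
    have up: "list_all fo_arg (?up gs)" "list_all fo_arg (?up hs @ [hd])"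
      using Cons.prems by (auto simp: list_all_iff fo_args)
    have "fo_rel (\<lambda>e. sat (map (\<lambda>h. h e) (?up hs @ [hd]) @
        map (trm_val (map (\<lambda>g. g e) (?up gs))) us) \<phi>)"
      using Cons.prems up by (intro Cons.IH) auto
    then have 1: "fo_rel (\<lambda>e. sat (map (\<lambda>h. h (tl e)) hs @ hd e #
        map (trm_val (map (\<lambda>g. g (tl e)) gs)) us) \<phi>)"
      by (simp add: comp_def)
    have "fo_rel (\<lambda>e. hd e = trm_val (map (\<lambda>g. g e) (?up gs)) u)"
      using Cons.prems up by (intro Fun.IH fo_args) auto
    then have 2: "fo_rel (\<lambda>e. hd e = trm_val (map (\<lambda>g. g (tl e)) gs) u)"
      by (simp add: comp_def)
    from fo_ex[of "\<lambda>y e. y = trm_val (map (\<lambda>g. g e) gs) u \<and> sat (map (\<lambda>h. h e) hs @ y #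
        map (trm_val (map (\<lambda>g. g e) gs)) us) \<phi>", OF fo_conj[OF 2 1]]
    show ?case by simp
  qed
  have "(f e = trm_val (map (\<lambda>g. g e) gs) (Fun \<phi> ts)) =
      sat (map (\<lambda>h. h e) [f] @ map (trm_val (map (\<lambda>g. g e) gs)) ts) \<phi>" for e
  proof -
    \<comment> \<open>Well-formedness makes the function symbol total and single-valued, so the
      definite description in \<open>trm_val\<close> satisfies its defining formula.\<close>
    have "\<exists>!y. sat (y # map (trm_val (map (\<lambda>g. g e) gs)) ts) \<phi>"
      using Fun.prems(1) by simp
    from theI'[OF this] this show ?thesis by auto
  qed
  then show ?case using *[of ts gs "[f]"] Fun.prems by auto
qed

text \<open>Terms enter a relation by naming their values first: \<exists>a b with \<open>a\<close>
  the value of \<open>s\<close>, \<open>b\<close> that of \<open>t\<close>, and \<open>R\<close>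
  holding of them. All atomic formulas are treated this way.\<close>

lemma fo_trm_val_subst:
  assumes R: "\<And>f g h. fo_arg f \<Longrightarrow> fo_arg g \<Longrightarrow> fo_arg h \<Longrightarrow> fo_rel (\<lambda>e. R (f e) (g e) (h e))"
    and wf: "wf_trm (length gs) s" "wf_trm (length gs) t" and args: "list_all fo_arg gs" "fo_arg f"
  shows "fo_rel (\<lambda>e. R (f e) (trm_val (map (\<lambda>g. g e) gs) s) (trm_val (map (\<lambda>g. g e) gs) t))"
proof -
  let ?gs = "map (\<lambda>g e. g (tl (tl e))) gs"
  have gs: "list_all fo_arg ?gs"
    using args by (auto simp: list_all_iff intro!: fo_arg_tl)
  have "fo_rel (\<lambda>e. hd (tl e) = trm_val (map (\<lambda>g. g e) ?gs) s)"
    "fo_rel (\<lambda>e. hd e = trm_val (map (\<lambda>g. g e) ?gs) t)"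
    using fo_trm_val[OF _ gs] wf fo_args by (simp_all del: map_map)
  then have "fo_rel (\<lambda>e. hd (tl e) = trm_val (map (\<lambda>g. g (tl (tl e))) gs) s)"
    "fo_rel (\<lambda>e. hd e = trm_val (map (\<lambda>g. g (tl (tl e))) gs) t)"
    by (simp_all add: comp_def)
  then have "fo_rel (\<lambda>e. \<exists>a b. a = trm_val (map (\<lambda>g. g e) gs) s \<and>
      b = trm_val (map (\<lambda>g. g e) gs) t \<and> R (f e) a b)"
    by (intro fo_ex fo_conj R fo_args args)
  then show ?thesis by simp
qed

end

section \<open>Set theory in the ground model\<close>

context ground_model
begin

section \<open>Separation and replacement for definable relations\<close>

lemma comprehension:
  assumes "fo_rel (\<lambda>e. R (hd e))"
  shows "\<exists>b. \<forall>x. x \<in>\<^sub>M b \<longleftrightarrow> x \<in>\<^sub>M a \<and> R x"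
proof -
  obtain \<phi> N where \<phi>: "\<And>e. N \<le> length e \<Longrightarrow> sat e \<phi> = R (hd e)"
    using assms unfolding fo_rel_def by blast
  \<comment> \<open>The padding \<open>replicate N a\<close> makes the environment long enough for
    \<phi> to be correct; its entries are irrelevant because \<open>R\<close> reads only the
    head.\<close>
  show ?thesis using separation[of a "replicate N a" \<phi>] by (simp add: \<phi>)
qed

text \<open>Replacement along the map sending \<open>x\<close> to the set of all \<open>y\<close>
  with \<open>R x y\<close>, single-valued by extensionality, followed by union.\<close>

lemma bounded_union:
  assumes R: "\<And>f g. fo_arg f \<Longrightarrow> fo_arg g \<Longrightarrow> fo_rel (\<lambda>e. R (f e) (g e))"
    and sets: "\<And>x. x \<in>\<^sub>M a \<Longrightarrow> \<exists>b. \<forall>y. y \<in>\<^sub>M b \<longleftrightarrow> R x y"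
  shows "\<exists>b. \<forall>y. y \<in>\<^sub>M b \<longleftrightarrow> (\<exists>x. x \<in>\<^sub>M a \<and> R x y)"
proof -
  have "fo_rel (\<lambda>e. \<forall>y. y \<in>\<^sub>M hd e \<longleftrightarrow> R (hd (tl e)) y)"
    by (intro fo_logic fo_args R)
  then obtain \<phi> N where
    \<phi>: "\<And>e. N \<le> length e \<Longrightarrow> sat e \<phi> = (\<forall>y. y \<in>\<^sub>M hd e \<longleftrightarrow> R (hd (tl e)) y)"
    unfolding fo_rel_def by blast
  obtain c where c: "\<forall>z. z \<in>\<^sub>M c \<longleftrightarrow> (\<exists>x. x \<in>\<^sub>M a \<and> (\<forall>y. y \<in>\<^sub>M z \<longleftrightarrow> R x y))"
    using replacement[of a "replicate N a" \<phi>] by (auto simp: \<phi> intro: extensionality)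
  obtain u where "\<forall>y. y \<in>\<^sub>M u \<longleftrightarrow> (\<exists>z. y \<in>\<^sub>M z \<and> z \<in>\<^sub>M c)"
    using union by blast
  then show ?thesis using c sets by (intro exI[of _ u]) metis
qed

section \<open>Pairs and adjunction of one element\<close>

lemma empty_exists: "\<exists>z. is_empty z"
  using infinity unfolding is_inductive_def by blast

lemma upair_exists: "\<exists>p. is_upair p a b"
  using pairing unfolding is_upair_def .

lemma pair_exists: "\<exists>p. is_pair p a b"
proof -
  obtain s where s: "is_upair s a a" using upair_exists by blast
  obtain t where t: "is_upair t a b" using upair_exists by blast
  obtain p where p: "is_upair p s t" using upair_exists by blast
  have "x = s" if "is_upair x a a" for x
    using that s unfolding is_upair_def by (auto intro: extensionality)
  moreover have "x = t" if "is_upair x a b" for x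
    using that t unfolding is_upair_def by (auto intro: extensionality)
  ultimately have "is_pair p a b"
    using s t p unfolding is_pair_def is_upair_def[of p] by metis
  then show ?thesis ..
qed

lemma pair_unique: "is_pair p a b \<Longrightarrow> is_pair q a b \<Longrightarrow> p = q"
  unfolding is_pair_def by (auto intro: extensionality)

lemma pair_inject:
  assumes "is_pair p a b" "is_pair p c d"
  shows "a = c \<and> b = d"
proof -
  obtain s where s: "is_upair s a a" using upair_exists by blast
  obtain t where t: "is_upair t a b" using upair_exists by blast
  obtain s' where s': "is_upair s' c c" using upair_exists by blast
  obtain t' where t': "is_upair t' c d" using upair_exists by blast
  have "s \<in>\<^sub>M p" "t \<in>\<^sub>M p" "s' \<in>\<^sub>M p" "t' \<in>\<^sub>M p"
    using assms s t s' t' unfolding is_pair_def by blast+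
  then have "is_upair s c c \<or> is_upair s c d" "is_upair t c c \<or> is_upair t c d"
    "is_upair s' a a \<or> is_upair s' a b" "is_upair t' a a \<or> is_upair t' a b"
    using assms unfolding is_pair_def by blast+
  then show ?thesis using s t s' t' unfolding is_upair_def by metis
qed

lemma pair_mem_iff: "is_pair p a b \<Longrightarrow> pair_mem a b c \<longleftrightarrow> p \<in>\<^sub>M c"
  unfolding pair_mem_def using pair_unique by blast

lemma insert_exists: "\<exists>b. \<forall>x. x \<in>\<^sub>M b \<longleftrightarrow> x \<in>\<^sub>M a \<or> x = c"
proof -
  obtain s where s: "\<forall>x. x \<in>\<^sub>M s \<longleftrightarrow> x = c \<or> x = c" using pairing by blast
  obtain t where t: "\<forall>x. x \<in>\<^sub>M t \<longleftrightarrow> x = a \<or> x = s" using pairing by blast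
  obtain u where u: "\<forall>x. x \<in>\<^sub>M u \<longleftrightarrow> (\<exists>y. x \<in>\<^sub>M y \<and> y \<in>\<^sub>M t)" using union by blast
  show ?thesis using s t u by (intro exI[of _ u]) auto
qed

lemma insert_pair_exists:
  "\<exists>u'. \<forall>k y. pair_mem k y u' \<longleftrightarrow> pair_mem k y u \<or> k = n \<and> y = z"
proof -
  obtain p where p: "is_pair p n z" using pair_exists by blast
  obtain u' where u': "\<forall>x. x \<in>\<^sub>M u' \<longleftrightarrow> x \<in>\<^sub>M u \<or> x = p" using insert_exists by blast
  have "pair_mem k y u' \<longleftrightarrow> pair_mem k y u \<or> k = n \<and> y = z" for k y
  proof
    assume "pair_mem k y u'"
    then obtain q where "is_pair q k y" "q \<in>\<^sub>M u \<or> q = p" unfolding pair_mem_def u'[rule_format] by blast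
    then show "pair_mem k y u \<or> k = n \<and> y = z" using p pair_inject unfolding pair_mem_def by blast
  next
    assume "pair_mem k y u \<or> k = n \<and> y = z"
    then show "pair_mem k y u'" using p u' unfolding pair_mem_def by blast
  qed
  then show ?thesis by blast
qed

section \<open>Foundation and ordinals\<close>

lemma mem_asym:
  assumes "a \<in>\<^sub>M b"
  shows "\<not> b \<in>\<^sub>M a"
proof -
  obtain p where p: "\<forall>x. x \<in>\<^sub>M p \<longleftrightarrow> x = a \<or> x = b" using pairing by blast
  then show ?thesis using foundation[of a p] assms by metis
qed

text \<open>Two distinct predecessors of \<open>s\<close> would be members of each other.\<close>

lemma succ_inject:
  assumes "is_succ s a" "is_succ s b"
  shows "a = b"
  using assms mem_asym unfolding is_succ_def by metis

lemma ordinal_mem: "is_ordinal a \<Longrightarrow> x \<in>\<^sub>M a \<Longrightarrow> is_ordinal x"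
  unfolding is_ordinal_def is_transitive_def by blast

text \<open>Foundation gives a minimal element of the part of \<open>a\<close> satisfying
  \<open>R\<close>; if that part is empty, \<open>a\<close> itself is least. Transitivity of
  \<open>a\<close> makes minimality inside \<open>a\<close> into minimality outright.\<close>

lemma ordinal_least:
  assumes "fo_rel (\<lambda>e. R (hd e))" "is_ordinal a" "R a"
  shows "\<exists>b. is_ordinal b \<and> R b \<and> (\<forall>x. x \<in>\<^sub>M b \<longrightarrow> \<not> R x)"
proof -
  obtain d where d: "\<forall>x. x \<in>\<^sub>M d \<longleftrightarrow> x \<in>\<^sub>M a \<and> R x"
    using comprehension[OF assms(1)] by blast
  show ?thesis
  proof (cases "\<exists>x. x \<in>\<^sub>M d")
    case True
    then obtain b where b: "b \<in>\<^sub>M d" "\<forall>z. z \<in>\<^sub>M b \<longrightarrow> \<not> z \<in>\<^sub>M d" using foundation by blast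
    then have "z \<in>\<^sub>M a" if "z \<in>\<^sub>M b" for z
      using d assms(2) that unfolding is_ordinal_def is_transitive_def by blast
    then show ?thesis using b d assms(2) ordinal_mem by blast
  next
    case False
    then show ?thesis using d assms by blast
  qed
qed

text \<open>Double minimality: \<open>c\<close> is least among the ordinals incomparable with some
  ordinal, and \<open>d\<close> is least among those incomparable with \<open>c\<close>. Then
  \<open>c\<close> and \<open>d\<close> have the same members.\<close>

lemma ordinal_linear:
  assumes "is_ordinal a" "is_ordinal b"
  shows "a \<in>\<^sub>M b \<or> a = b \<or> b \<in>\<^sub>M a"
proof (rule ccontr)
  let ?cmp = "\<lambda>x y. x \<in>\<^sub>M y \<or> x = y \<or> y \<in>\<^sub>M x"
  assume ab: "\<not> ?cmp a b"
  have "fo_rel (\<lambda>e. \<exists>y. is_ordinal y \<and> \<not> ?cmp (hd e) y)"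
    by (intro fo_logic fo_ordinal fo_args)
  from ordinal_least[of "\<lambda>x. \<exists>y. is_ordinal y \<and> \<not> ?cmp x y", OF this assms(1)] ab assms
  obtain c where c: "is_ordinal c" "\<exists>y. is_ordinal y \<and> \<not> ?cmp c y"
    "\<And>x y. x \<in>\<^sub>M c \<Longrightarrow> is_ordinal y \<Longrightarrow> ?cmp x y" by blast
  then obtain y where y: "is_ordinal y" "\<not> ?cmp c y" by blast
  have "fo_rel (\<lambda>e. \<not> ?cmp c (hd e))"
    by (intro fo_logic fo_args)
  from ordinal_least[of "\<lambda>y. \<not> ?cmp c y", OF this y]
  obtain d where d: "is_ordinal d" "\<not> ?cmp c d" "\<And>x. x \<in>\<^sub>M d \<Longrightarrow> ?cmp c x" by blast
  have "x \<in>\<^sub>M d" if "x \<in>\<^sub>M c" for x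
    using c(3)[OF that d(1)] that c(1) d(2) unfolding is_ordinal_def is_transitive_def by blast
  moreover have "x \<in>\<^sub>M c" if "x \<in>\<^sub>M d" for x
    using d(3)[OF that] that d(1,2) unfolding is_ordinal_def is_transitive_def by blast
  ultimately have "c = d" by (auto intro: extensionality)
  then show False using d(2) by blast
qed

section \<open>Levels of the constructible hierarchy\<close>

lemma L_sequence_dom:
  assumes "L_sequence f a" "pair_mem b l f"
  shows "b \<in>\<^sub>M a"
proof -
  obtain B where "is_function f a B" using assms(1) unfolding L_sequence_def by blast
  then show ?thesis using assms(2) unfolding is_function_def pair_mem_def
    using pair_inject by metis
qed

lemma L_level_ordinal: "L_level b l \<Longrightarrow> is_ordinal b"
  unfolding L_level_def using L_sequence_dom ordinal_mem L_sequence_def by metis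

text \<open>At a least index with two different levels, both are determined by the earlier levels,
  which are unique by minimality.\<close>

lemma L_level_unique:
  assumes "L_level b l" "L_level b l'"
  shows "l = l'"
proof (rule ccontr)
  assume "l \<noteq> l'"
  let ?R = "\<lambda>b. \<exists>l l'. L_level b l \<and> L_level b l' \<and> l \<noteq> l'"
  have "fo_rel (\<lambda>e. ?R (hd e))"
    by (intro fo_logic fo_L_level fo_args)
  from ordinal_least[of ?R, OF this L_level_ordinal[OF assms(1)]] assms \<open>l \<noteq> l'\<close>
  obtain c m m' where c: "L_level c m" "L_level c m'" "m \<noteq> m'"
    "\<And>x k k'. x \<in>\<^sub>M c \<Longrightarrow> L_level x k \<Longrightarrow> L_level x k' \<Longrightarrow> k = k'" by blast
  have sub: "y \<in>\<^sub>M k'" if k: "L_level c k" "L_level c k'" "y \<in>\<^sub>M k" for k k' y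
  proof -
    obtain f a where f: "L_sequence f a" "pair_mem c k f" using k unfolding L_level_def by blast
    obtain g b where g: "L_sequence g b" "pair_mem c k' g" using k unfolding L_level_def by blast
    obtain x j where x: "x \<in>\<^sub>M c" "pair_mem x j f" "definable_subset y j"
      using f k(3) unfolding L_sequence_def by blast
    \<comment> \<open>The domain \<open>b\<close> of \<open>g\<close> is transitive and contains
      \<open>c\<close>, so \<open>g\<close> is defined at every index below
      \<open>c\<close>.\<close>
    have "x \<in>\<^sub>M b"
      using x(1) L_sequence_dom[OF g] g(1)
      unfolding L_sequence_def is_ordinal_def is_transitive_def by blast
    then obtain j' where j': "pair_mem x j' g"
      using g(1) unfolding L_sequence_def is_function_def by blast
    then have "j = j'" using c(4) x f g unfolding L_level_def by blast
    then show ?thesis using g x j' unfolding L_sequence_def by blast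
  qed
  have "m = m'" using sub[of m m'] sub[of m' m] c by (intro extensionality) blast
  then show False using c by blast
qed

text \<open>V = L enters here: the definable levels exhaust the model, so every solvable condition
  has witnesses of least level.\<close>

lemma L_level_exists: "\<exists>b l. L_level b l \<and> x \<in>\<^sub>M l"
  using V_eq_L[of x] unfolding constructible_def L_level_def by blast

text \<open>
  Scott's trick, with the constructible hierarchy in place of the rank: the witnesses of least
  level form a set.
\<close>

definition least_witness :: "('m \<Rightarrow> bool) \<Rightarrow> 'm \<Rightarrow> bool" where
  "least_witness W y \<longleftrightarrow> W y \<and> (\<exists>b l. L_level b l \<and> y \<in>\<^sub>M l \<and>
     (\<forall>c k z. c \<in>\<^sub>M b \<longrightarrow> L_level c k \<longrightarrow> z \<in>\<^sub>M k \<longrightarrow> \<not> W z))"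

lemma least_witnesses:
  assumes W: "\<And>f. fo_arg f \<Longrightarrow> fo_rel (\<lambda>e. W (f e))"
  shows least_witness_set: "\<exists>b. \<forall>y. y \<in>\<^sub>M b \<longleftrightarrow> least_witness W y"
    and least_witness_exists: "W x \<Longrightarrow> \<exists>y. least_witness W y"
proof -
  have main: "(\<exists>b. \<forall>y. y \<in>\<^sub>M b \<longleftrightarrow> least_witness W y) \<and> (\<exists>y. least_witness W y)" if Wx: "W x" for x
  proof -
    let ?Q = "\<lambda>b. \<exists>l z. L_level b l \<and> z \<in>\<^sub>M l \<and> W z"
    have "fo_rel (\<lambda>e. ?Q (hd e))"
      by (intro fo_logic fo_L_level W fo_args)
    moreover obtain b0 l0 where b0: "L_level b0 l0" "x \<in>\<^sub>M l0" using L_level_exists by blast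
    moreover have "?Q b0" using b0 Wx by blast
    ultimately obtain b where b: "is_ordinal b" "?Q b" "\<And>c. c \<in>\<^sub>M b \<Longrightarrow> \<not> ?Q c"
      using ordinal_least[of ?Q b0, OF _ L_level_ordinal] by blast
    then obtain l z where l: "L_level b l" "z \<in>\<^sub>M l" "W z" by blast
    \<comment> \<open>By linearity of the ordinals, a level of least index containing a witness must
      have index \<open>b\<close>; by uniqueness of levels it is \<open>l\<close>. Hence the least
      witnesses are separated from the single set \<open>l\<close>.\<close>
    have eq: "least_witness W y \<longleftrightarrow> y \<in>\<^sub>M l \<and> W y" for y
    proof
      assume "least_witness W y"
      then obtain c k where c: "W y" "L_level c k" "y \<in>\<^sub>M k" "\<not> b \<in>\<^sub>M c"
        using l unfolding least_witness_def by blast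
      then have "c = b"
        using b(3) ordinal_linear[OF b(1) L_level_ordinal[OF c(2)]] by blast
      then show "y \<in>\<^sub>M l \<and> W y" using c l L_level_unique by blast
    next
      assume "y \<in>\<^sub>M l \<and> W y"
      then show "least_witness W y" using l(1) b(3) unfolding least_witness_def by blast
    qed
    have "fo_rel (\<lambda>e. W (hd e))" by (intro W fo_args)
    from comprehension[of W, OF this] show ?thesis using eq l by blast
  qed
  show "\<exists>b. \<forall>y. y \<in>\<^sub>M b \<longleftrightarrow> least_witness W y"
  proof (cases "\<exists>x. W x")
    case False
    then show ?thesis using empty_exists unfolding least_witness_def is_empty_def by blast
  qed (use main in blast)
  show "\<exists>y. least_witness W y" if "W x"
    using main[OF that] by blast
qed

text \<open>
  Stages of the closure are indexed by an inductive set. A derivation is a set \<open>u\<close> of pairs in which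
  every pair is justified by the rules generating the stages; this avoids \<open>\<omega>\<close> and the uniqueness
  part of recursion.
\<close>

lemma closed_set_exists:
  assumes R: "\<And>f g. fo_arg f \<Longrightarrow> fo_arg g \<Longrightarrow> fo_rel (\<lambda>e. R (f e) (g e))"
    and sets: "\<And>x. \<exists>b. \<forall>y. y \<in>\<^sub>M b \<longleftrightarrow> R x y"
  shows "\<exists>T. a \<in>\<^sub>M T \<and> (\<forall>x y. x \<in>\<^sub>M T \<longrightarrow> R x y \<longrightarrow> y \<in>\<^sub>M T)"
proof -
  define derivation where "derivation u \<longleftrightarrow> (\<forall>n y. pair_mem n y u \<longrightarrow>
    is_empty n \<and> y = a \<or> (\<exists>m x. is_succ n m \<and> pair_mem m x u \<and> R x y))" for u
  define stage where "stage n y \<longleftrightarrow> (\<exists>u. derivation u \<and> pair_mem n y u)" for n y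
  have fo_stage: "fo_rel (\<lambda>e. stage (f e) (g e))" if "fo_arg f" "fo_arg g" for f g
    unfolding stage_def derivation_def
    by (intro fo_logic fo_pair_mem fo_empty fo_succ R fo_args that)
  have stage_0: "stage n y \<longleftrightarrow> y = a" if n: "is_empty n" for n y
  proof
    assume "stage n y"
    \<comment> \<open>An empty index is not a successor, so only the first clause can justify the
      pair.\<close>
    then show "y = a" using n unfolding stage_def derivation_def is_empty_def is_succ_def by blast
  next
    assume y: "y = a"
    obtain z where "is_empty z" using empty_exists by blast
    then have "\<not> pair_mem k x z" for k x unfolding is_empty_def pair_mem_def by blast
    then obtain u where "\<And>k x. pair_mem k x u \<longleftrightarrow> k = n \<and> x = a"
      using insert_pair_exists[of z n a] by blast
    then show "stage n y" using n y unfolding stage_def derivation_def by (intro exI[of _ u]) simp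
  qed
  have stage_succ: "stage s y \<longleftrightarrow> (\<exists>x. stage n x \<and> R x y)" if s: "is_succ s n" for s n y
  proof
    assume "stage s y"
    then obtain u where u: "derivation u" "pair_mem s y u" unfolding stage_def by blast
    have "\<not> is_empty s" using s unfolding is_empty_def is_succ_def by blast
    then obtain m x where "is_succ s m" "pair_mem m x u" "R x y"
      using u unfolding derivation_def by blast
    then show "\<exists>x. stage n x \<and> R x y" using succ_inject[OF s] u unfolding stage_def by blast
  next
    assume "\<exists>x. stage n x \<and> R x y"
    then obtain x u where x: "R x y" "derivation u" "pair_mem n x u" unfolding stage_def by blast
    obtain u' where u': "\<And>k x. pair_mem k x u' \<longleftrightarrow> pair_mem k x u \<or> k = s \<and> x = y"
      using insert_pair_exists[of u s y] by blast
    \<comment> \<open>The added pair is justified by the pair of \<open>n\<close> and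
      \<open>x\<close> in \<open>u\<close>; the old justifications survive in the larger
      set.\<close>
    have "derivation u'" using x s unfolding derivation_def u' by blast
    then show "stage s y" using u' unfolding stage_def by blast
  qed
  let ?small = "\<lambda>n. \<exists>b. \<forall>y. y \<in>\<^sub>M b \<longleftrightarrow> stage n y"
  obtain w where w: "is_inductive w" using infinity by blast
  \<comment> \<open>In place of induction over the natural numbers, the indices in \<open>w\<close>
    whose stage is a set are separated. The resulting \<open>v\<close> contains an empty set and a
    successor of each of its members, which suffices to close the union of its stages under
    \<open>R\<close>.\<close>
  have "fo_rel (\<lambda>e. ?small (hd e))" by (intro fo_logic fo_stage fo_args)
  then obtain v where v: "\<forall>n. n \<in>\<^sub>M v \<longleftrightarrow> n \<in>\<^sub>M w \<and> ?small n"
    using comprehension[of ?small w] by blast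
  have small_0: "?small n" if "is_empty n" for n
    using stage_0[OF that] pairing[of a a] by simp
  have small_succ: "?small s" if "is_succ s n" "?small n" for s n
  proof -
    obtain b where b: "\<forall>y. y \<in>\<^sub>M b \<longleftrightarrow> stage n y" using \<open>?small n\<close> by blast
    have "\<exists>d. \<forall>y. y \<in>\<^sub>M d \<longleftrightarrow> (\<exists>x. x \<in>\<^sub>M b \<and> R x y)"
      by (rule bounded_union, rule R, assumption+, rule sets)
    then show ?thesis unfolding stage_succ[OF that(1)] using b by simp
  qed
  obtain z where z: "is_empty z" "z \<in>\<^sub>M v" using w v small_0 unfolding is_inductive_def by blast
  have vs: "\<exists>s. is_succ s n \<and> s \<in>\<^sub>M v" if "n \<in>\<^sub>M v" for n
  proof -
    have n: "n \<in>\<^sub>M w" "?small n" using v that by simp_all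
    obtain s where s: "is_succ s n" "s \<in>\<^sub>M w" using w n(1) unfolding is_inductive_def by blast
    have "s \<in>\<^sub>M v" using v s(2) small_succ[OF s(1) n(2)] by simp
    then show ?thesis using s(1) by blast
  qed
  have "?small n" if "n \<in>\<^sub>M v" for n using v that by simp
  then have "\<exists>T. \<forall>y. y \<in>\<^sub>M T \<longleftrightarrow> (\<exists>n. n \<in>\<^sub>M v \<and> stage n y)"
    by (intro bounded_union fo_stage)
  then obtain T where T: "\<forall>y. y \<in>\<^sub>M T \<longleftrightarrow> (\<exists>n. n \<in>\<^sub>M v \<and> stage n y)" ..
  have "a \<in>\<^sub>M T" using T z stage_0 by blast
  moreover have "y \<in>\<^sub>M T" if xy: "x \<in>\<^sub>M T" "R x y" for x y
  proof -
    obtain n where n: "n \<in>\<^sub>M v" "stage n x" using T xy(1) by blast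
    obtain s where s: "is_succ s n" "s \<in>\<^sub>M v" using vs[OF n(1)] by blast
    have "stage s y" unfolding stage_succ[OF s(1)] using n(2) xy(2) by blast
    then show ?thesis using T s(2) by blast
  qed
  ultimately show ?thesis by blast
qed

text \<open>Closing under all witnesses of least level, rather than one selected witness, avoids
  choice. For each \<open>x\<close> these form a set, because \<open>p\<close> ranges over the set
  \<open>s\<close>.\<close>

lemma witness_closed_set_exists:
  assumes W: "\<And>f g h. fo_arg f \<Longrightarrow> fo_arg g \<Longrightarrow> fo_arg h \<Longrightarrow> fo_rel (\<lambda>e. W (f e) (g e) (h e))"
  shows "\<exists>T. a \<in>\<^sub>M T \<and> (\<forall>x p y. x \<in>\<^sub>M T \<longrightarrow> p \<in>\<^sub>M s \<longrightarrow> W x p y \<longrightarrow> (\<exists>y. y \<in>\<^sub>M T \<and> W x p y))"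
proof -
  let ?R = "\<lambda>x y. \<exists>p. p \<in>\<^sub>M s \<and> least_witness (W x p) y"
  have lw: "fo_rel (\<lambda>e. least_witness (W (f e) (g e)) (h e))"
    if "fo_arg f" "fo_arg g" "fo_arg h" for f g h
    unfolding least_witness_def by (intro fo_logic fo_L_level W fo_args that)
  have Wx: "fo_rel (\<lambda>e. W x p (f e))" if "fo_arg f" for x p f
    by (intro W fo_args that)
  have "\<exists>T. a \<in>\<^sub>M T \<and> (\<forall>x y. x \<in>\<^sub>M T \<longrightarrow> ?R x y \<longrightarrow> y \<in>\<^sub>M T)"
  proof (rule closed_set_exists)
    show "fo_rel (\<lambda>e. ?R (f e) (g e))" if "fo_arg f" "fo_arg g" for f g
      by (intro fo_logic lw fo_args that)
    show "\<exists>b. \<forall>y. y \<in>\<^sub>M b \<longleftrightarrow> ?R x y" for x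
    proof (rule bounded_union)
      show "fo_rel (\<lambda>e. least_witness (W x (f e)) (g e))" if "fo_arg f" "fo_arg g" for f g
        by (intro lw fo_args that)
      show "\<exists>b. \<forall>y. y \<in>\<^sub>M b \<longleftrightarrow> least_witness (W x p) y" for p
        by (intro least_witness_set Wx)
    qed
  qed
  then obtain T where T: "a \<in>\<^sub>M T" "\<And>x p y. x \<in>\<^sub>M T \<Longrightarrow> p \<in>\<^sub>M s \<Longrightarrow> least_witness (W x p) y \<Longrightarrow> y \<in>\<^sub>M T"
    by blast
  have "\<exists>y. y \<in>\<^sub>M T \<and> W x p y" if "x \<in>\<^sub>M T" "p \<in>\<^sub>M s" "W x p y" for x p y
  proof -
    obtain z where "least_witness (W x p) z"
      using least_witness_exists[of "W x p", OF Wx] \<open>W x p y\<close> by blast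
    then show ?thesis using T that unfolding least_witness_def by blast
  qed
  then show ?thesis using T(1) by blast
qed

end

section \<open>Truth values are definable in the ground model\<close>

context realizability_model
begin

text \<open>
  Shifting by \<open>tl ^^ k\<close> builds weakening into the notion, so that \<open>X\<close> can be used under quantifiers.
\<close>

definition fo_set :: "('m list \<Rightarrow> 'm set) \<Rightarrow> bool" where
  "fo_set X \<longleftrightarrow> (\<forall>k f. fo_arg f \<longrightarrow> fo_rel (\<lambda>e. f e \<in> X ((tl ^^ k) e)))"

lemma fo_set_mem: "fo_set X \<Longrightarrow> fo_arg f \<Longrightarrow> fo_rel (\<lambda>e. f e \<in> X e)"
  unfolding fo_set_def by (drule spec[of _ 0]) simp

lemma fo_set_tl: "fo_set X \<Longrightarrow> fo_set (\<lambda>e. X (tl e))"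
  unfolding fo_set_def
proof (intro allI impI)
  fix k f assume "\<forall>k f. fo_arg f \<longrightarrow> fo_rel (\<lambda>e. f e \<in> X ((tl ^^ k) e))" "fo_arg f"
  then have "fo_rel (\<lambda>e. f e \<in> X ((tl ^^ Suc k) e))" by blast
  then show "fo_rel (\<lambda>e. f e \<in> X (tl ((tl ^^ k) e)))" by simp
qed

lemma fo_set_funpow_tl: "fo_set X \<Longrightarrow> fo_set (\<lambda>e. X ((tl ^^ k) e))"
proof (induction k)
  case (Suc k)
  then show ?case using fo_set_tl[of "\<lambda>e. X ((tl ^^ k) e)"] by (simp add: funpow_Suc_right del: funpow.simps)
qed simp

lemma fo_arg_funpow_tl: "fo_arg f \<Longrightarrow> fo_arg (\<lambda>e. f ((tl ^^ k) e))"
proof (induction k)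
  case (Suc k)
  then show ?case using fo_arg_tl[of "\<lambda>e. f ((tl ^^ k) e)"] by (simp add: funpow_Suc_right del: funpow.simps)
qed simp

text \<open>Shifting the environment amounts to composing the arguments with \<open>tl ^^ k\<close>,
  which are again admissible. This turns induction hypotheses about argument lists into the
  shift-stable form required for \<open>imp_val\<close>.\<close>

lemma fo_setI:
  assumes "\<And>gs f. length gs = n \<Longrightarrow> list_all fo_arg gs \<Longrightarrow> fo_arg f \<Longrightarrow>
      fo_rel (\<lambda>e. f e \<in> X (map (\<lambda>g. g e) gs))"
    and "length gs = n" "list_all fo_arg gs"
  shows "fo_set (\<lambda>e. X (map (\<lambda>g. g e) gs))"
  unfolding fo_set_def
proof (intro allI impI)
  fix k f assume f: "fo_arg f"
  let ?gs = "map (\<lambda>g e. g ((tl ^^ k) e)) gs"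
  have "list_all fo_arg ?gs"
    using assms(3) by (auto simp: list_all_iff fo_arg_funpow_tl)
  then have "fo_rel (\<lambda>e. f e \<in> X (map (\<lambda>g. g e) ?gs))"
    using assms(1)[of ?gs f] assms(2) f by simp
  then show "fo_rel (\<lambda>e. f e \<in> X (map (\<lambda>g. g ((tl ^^ k) e)) gs))"
    by (simp add: comp_def)
qed

text \<open>The operations of the algebra are functions outside the model, so \<open>op x y\<close>
  is not an admissible argument. Restricted to sets their graphs are individuals, hence the
  membership conditions.\<close>

definition op_graph :: "('m \<Rightarrow> 'm \<Rightarrow> 'm) \<Rightarrow> 'm \<Rightarrow> 'm \<Rightarrow> 'm \<Rightarrow> 'm \<Rightarrow> 'm \<Rightarrow> bool" where
  "op_graph op a b x y z \<longleftrightarrow> x \<in>\<^sub>M a \<and> y \<in>\<^sub>M b \<and> z = op x y"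

lemma fo_op_graph:
  assumes "binary_op op a b c" and args: "fo_arg x" "fo_arg y" "fo_arg z"
  shows "fo_rel (\<lambda>e. op_graph op a b (x e) (y e) (z e))"
proof -
  obtain g where g: "\<And>p. p \<in>\<^sub>M g \<longleftrightarrow>
      (\<exists>x y q. x \<in>\<^sub>M a \<and> y \<in>\<^sub>M b \<and> is_pair q x y \<and> is_pair p q (op x y))"
    using assms(1) unfolding binary_op_def by blast
  have "u \<in>\<^sub>M a \<and> v \<in>\<^sub>M b \<and> w = op u v \<longleftrightarrow> (\<exists>q p. is_pair q u v \<and> is_pair p q w \<and> p \<in>\<^sub>M g)" for u v w
  proof
    assume uvw: "u \<in>\<^sub>M a \<and> v \<in>\<^sub>M b \<and> w = op u v"
    obtain q p where "is_pair q u v" "is_pair p q w" using pair_exists by blast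
    then show "\<exists>q p. is_pair q u v \<and> is_pair p q w \<and> p \<in>\<^sub>M g" using g uvw by blast
  next
    assume "\<exists>q p. is_pair q u v \<and> is_pair p q w \<and> p \<in>\<^sub>M g"
    then obtain q p x y q' where "is_pair q u v" "is_pair p q w" "x \<in>\<^sub>M a" "y \<in>\<^sub>M b"
      "is_pair q' x y" "is_pair p q' (op x y)" unfolding g by blast
    then show "u \<in>\<^sub>M a \<and> v \<in>\<^sub>M b \<and> w = op u v" using pair_inject by blast
  qed
  then have eq: "(\<lambda>e. op_graph op a b (x e) (y e) (z e)) =
      (\<lambda>e. \<exists>q p. is_pair q (x e) (y e) \<and> is_pair p q (z e) \<and> p \<in>\<^sub>M g)"
    unfolding op_graph_def by simp
  show ?thesis unfolding eq
    by (intro fo_logic fo_pair fo_args args)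
qed

lemmas fo_push = fo_op_graph[OF push_op]

section \<open>Orthogonals and implication of truth values\<close>

lemma orth_terms: "\<xi> \<in> orth X \<Longrightarrow> \<xi> \<in>\<^sub>M terms A"
  unfolding orth_def by simp

lemma push_stacks: "\<xi> \<in>\<^sub>M terms A \<Longrightarrow> \<pi> \<in>\<^sub>M stacks A \<Longrightarrow> push A \<xi> \<pi> \<in>\<^sub>M stacks A"
  using push_op unfolding binary_op_def by blast

definition stack_set :: "'m set \<Rightarrow> bool" where
  "stack_set X \<longleftrightarrow> (\<forall>\<pi>\<in>X. \<pi> \<in>\<^sub>M stacks A)"

text \<open>Membership in the pole is expressed through the graph of \<open>process\<close>, which
  is faithful only on stacks; this is why \<open>stack_set\<close> is assumed.\<close>

lemma fo_orth_mem:
  assumes "fo_set X" "\<And>e. stack_set (X e)" "fo_arg f"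
  shows "fo_rel (\<lambda>e. f e \<in> orth (X e))"
proof -
  have eq: "(\<lambda>e. f e \<in> orth (X e)) = (\<lambda>e. f e \<in>\<^sub>M terms A \<and> (\<forall>\<pi>. \<pi> \<in> X e \<longrightarrow>
     (\<exists>p. op_graph (process A) (terms A) (stacks A) (f e) \<pi> p \<and> p \<in>\<^sub>M pole A)))"
    using assms(2) unfolding orth_def stack_set_def op_graph_def by (intro ext) auto
  show ?thesis unfolding eq
    by (intro fo_logic fo_op_graph[OF process_op] fo_set_mem fo_set_tl fo_args assms)
qed

lemma fo_orth:
  assumes "fo_set X" "\<And>e. stack_set (X e)"
  shows "fo_set (\<lambda>e. orth (X e))"
  using fo_orth_mem[OF fo_set_funpow_tl] assms unfolding fo_set_def[of "\<lambda>e. orth (X e)"] by simp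

text \<open>Implication on arbitrary sets of stacks, so that it also applies to unions and
  restrictions that are not written as formulas.\<close>

definition imp_val :: "'m set \<Rightarrow> 'm set \<Rightarrow> 'm set" where
  "imp_val X Y = {push A \<xi> \<pi> | \<xi> \<pi>. \<xi> \<in> orth X \<and> \<pi> \<in> Y}"

declare truth_val.simps(5) [simp del]

lemma truth_val_Imp [simp]: "truth_val e (Imp F G) = imp_val (truth_val e F) (truth_val e G)"
  by (simp add: truth_val.simps(5) imp_val_def)

lemma stack_set_imp_val: "stack_set Y \<Longrightarrow> stack_set (imp_val X Y)"
  unfolding stack_set_def imp_val_def by (auto intro: push_stacks orth_terms)

lemma fo_imp_val_mem:
  assumes "fo_set X" "\<And>e. stack_set (X e)" "fo_set Y" "\<And>e. stack_set (Y e)" "fo_arg f"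
  shows "fo_rel (\<lambda>e. f e \<in> imp_val (X e) (Y e))"
proof -
  have eq: "(\<lambda>e. f e \<in> imp_val (X e) (Y e)) = (\<lambda>e. \<exists>\<xi> \<pi>.
     op_graph (push A) (terms A) (stacks A) \<xi> \<pi> (f e) \<and> \<xi> \<in> orth (X e) \<and> \<pi> \<in> Y e)"
    using assms(4) orth_terms unfolding imp_val_def stack_set_def op_graph_def by (intro ext) blast
  show ?thesis unfolding eq
    by (intro fo_logic fo_push fo_orth fo_set_mem fo_set_tl fo_args assms)
qed

section \<open>Definability of the atomic tables and of all truth values\<close>

lemma fo_row:
  assumes "fo_arg s" "fo_arg a" "fo_arg b"
  shows "fo_set (\<lambda>e. row (s e) (a e) (b e))"
  unfolding fo_set_def row_def mem_Collect_eq
  by (intro allI impI fo_logic fo_pair fo_pair_mem fo_args fo_arg_funpow_tl assms)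

lemma stack_set_row: "stack_set (row s a b)"
  unfolding stack_set_def row_def by simp

text \<open>The set equations become equivalences built from graphs of \<open>push\<close>, the
  shape to which the definability rules apply. The extra variable \<sigma> names the inner stack,
  which is a stack by \<open>push_stacks\<close>.\<close>

lemma atomic_tables_alt:
  "atomic_tables T S N \<longleftrightarrow> is_transitive T \<and>
     (\<forall>a b. a \<in>\<^sub>M T \<and> b \<in>\<^sub>M T \<longrightarrow>
        (\<forall>\<rho>. \<rho> \<in> row S a b \<longleftrightarrow> (\<exists>\<xi> \<pi> c. op_graph (push A) (terms A) (stacks A) \<xi> \<pi> \<rho> \<and>
            pair_mem c \<pi> a \<and> \<xi> \<in> orth (row N c b))) \<and>
        (\<forall>\<rho>. \<rho> \<in> row N a b \<longleftrightarrow> (\<exists>\<xi> \<xi>' \<pi> c \<sigma>.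
            op_graph (push A) (terms A) (stacks A) \<xi>' \<pi> \<sigma> \<and>
            op_graph (push A) (terms A) (stacks A) \<xi> \<sigma> \<rho> \<and>
            pair_mem c \<pi> b \<and> \<xi> \<in> orth (row S a c) \<and> \<xi>' \<in> orth (row S c a))))"
proof -
  have eq1: "\<rho> \<in> {push A \<xi> \<pi> | \<xi> \<pi> c. \<pi> \<in>\<^sub>M stacks A \<and> pair_mem c \<pi> a \<and> \<xi> \<in> orth (row N c b)} \<longleftrightarrow>
      (\<exists>\<xi> \<pi> c. op_graph (push A) (terms A) (stacks A) \<xi> \<pi> \<rho> \<and>
            pair_mem c \<pi> a \<and> \<xi> \<in> orth (row N c b))" for \<rho> a b
    using orth_terms unfolding op_graph_def by blast
  have eq2: "\<rho> \<in> {push A \<xi> (push A \<xi>' \<pi>) | \<xi> \<xi>' \<pi> c.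
            \<pi> \<in>\<^sub>M stacks A \<and> pair_mem c \<pi> b \<and>
            \<xi> \<in> orth (row S a c) \<and> \<xi>' \<in> orth (row S c a)} \<longleftrightarrow> (\<exists>\<xi> \<xi>' \<pi> c \<sigma>.
            op_graph (push A) (terms A) (stacks A) \<xi>' \<pi> \<sigma> \<and>
            op_graph (push A) (terms A) (stacks A) \<xi> \<sigma> \<rho> \<and>
            pair_mem c \<pi> b \<and> \<xi> \<in> orth (row S a c) \<and> \<xi>' \<in> orth (row S c a))" for \<rho> a b
    using orth_terms push_stacks unfolding op_graph_def by blast
  show ?thesis
    unfolding atomic_tables_def set_eq_iff eq1 eq2 ..
qed

lemma fo_atomic_tables:
  assumes "fo_arg t" "fo_arg s" "fo_arg n"
  shows "fo_rel (\<lambda>e. atomic_tables (t e) (s e) (n e))"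
  unfolding atomic_tables_alt
  by (intro fo_logic fo_transitive fo_push fo_pair_mem fo_set_mem fo_orth fo_row stack_set_row
      fo_args assms)

lemma stack_set_truth_val: "stack_set (truth_val e F)"
proof (induction F arbitrary: e)
  case (Imp F G)
  then show ?case using stack_set_imp_val by simp
qed (auto simp: stack_set_def sub_val_def notin_val_def row_def)

text \<open>Induction on the formula. For \<open>NotIn\<close> and \<open>Sub\<close> the tables are
  individuals, so quantifying over them is first-order.\<close>

lemma fo_truth_val:
  assumes "wf_fm (length gs) F" "list_all fo_arg gs" "fo_arg f"
  shows "fo_rel (\<lambda>e. f e \<in> truth_val (map (\<lambda>g. g e) gs) F)"
  using assms
proof (induction F arbitrary: gs f)
  case (Imp F G)
  have "fo_set (\<lambda>e. truth_val (map (\<lambda>g. g e) gs) F)"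
    by (rule fo_setI[of "length gs"]) (use Imp in auto)
  moreover have "fo_set (\<lambda>e. truth_val (map (\<lambda>g. g e) gs) G)"
    by (rule fo_setI[of "length gs"]) (use Imp in auto)
  ultimately show ?case
    using fo_imp_val_mem stack_set_truth_val Imp.prems(3) by simp
next
  case (All F)
  let ?gs = "hd # map (\<lambda>g e. g (tl e)) gs"
  have "list_all fo_arg ?gs"
    using All.prems by (auto simp: list_all_iff fo_args)
  then have "fo_rel (\<lambda>e. f (tl e) \<in> truth_val (map (\<lambda>g. g e) ?gs) F)"
    using All.prems by (intro All.IH fo_args) auto
  then have "fo_rel (\<lambda>e. f (tl e) \<in> truth_val (hd e # map (\<lambda>g. g (tl e)) gs) F)"
    by (simp add: comp_def)
  from fo_ex[of "\<lambda>a e. f e \<in> truth_val (a # map (\<lambda>g. g e) gs) F", OF this] show ?case by simp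
next
  case Bot
  then show ?case by (auto intro!: fo_logic fo_args)
next
  case (NotEps s t)
  show ?case unfolding truth_val.simps mem_Collect_eq
    by (rule fo_trm_val_subst[where R = "\<lambda>\<pi> a b. \<pi> \<in>\<^sub>M stacks A \<and> pair_mem a \<pi> b"])
      (use NotEps in \<open>auto intro!: fo_logic fo_pair_mem fo_args\<close>)
next
  case (NotIn s t)
  show ?case unfolding truth_val.simps notin_val_def mem_Collect_eq
    by (rule fo_trm_val_subst[where R = "\<lambda>\<pi> a b. \<exists>T S N. atomic_tables T S N \<and> a \<in>\<^sub>M T \<and>
            b \<in>\<^sub>M T \<and> \<pi> \<in> row N a b"])
      (use NotIn in \<open>auto intro!: fo_logic fo_atomic_tables fo_set_mem fo_row fo_args\<close>)
next
  case (Sub s t)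
  show ?case unfolding truth_val.simps sub_val_def mem_Collect_eq
    by (rule fo_trm_val_subst[where R = "\<lambda>\<pi> a b. \<exists>T S N. atomic_tables T S N \<and> a \<in>\<^sub>M T \<and>
            b \<in>\<^sub>M T \<and> \<pi> \<in> row S a b"])
      (use Sub in \<open>auto intro!: fo_logic fo_atomic_tables fo_set_mem fo_row fo_args\<close>)
qed

text \<open>The fixed individuals \<open>ps\<close> are treated as constant arguments.\<close>

lemma fo_truth_val_params:
  assumes "wf_fm (length gs + length ps) F" "list_all fo_arg gs" "fo_arg f"
  shows "fo_rel (\<lambda>e. f e \<in> truth_val (map (\<lambda>g. g e) gs @ ps) F)"
proof -
  let ?gs = "gs @ map (\<lambda>p e. p) ps"
  have "fo_rel (\<lambda>e. f e \<in> truth_val (map (\<lambda>g. g e) ?gs) F)"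
    using assms by (intro fo_truth_val) (auto simp: list_all_iff fo_arg_const)
  then show ?thesis by (simp add: comp_def)
qed

section \<open>Renaming, weakening and universal closure\<close>

lemma trm_val_ren:
  "wf_trm n t \<Longrightarrow> (\<And>i. i < n \<Longrightarrow> e' ! r i = e ! i) \<Longrightarrow> trm_val e' (ren_trm r t) = trm_val e t"
proof (induction t)
  case (Fun \<phi> ts)
  then have "map (trm_val e') (map (ren_trm r) ts) = map (trm_val e) ts"
    by simp
  then show ?case by (simp only: ren_trm.simps trm_val.simps)
qed simp_all

lemma truth_val_ren:
  "wf_fm n F \<Longrightarrow> (\<And>i. i < n \<Longrightarrow> e' ! r i = e ! i) \<Longrightarrow> truth_val e' (ren r F) = truth_val e F"
proof (induction F arbitrary: n e e' r)
  case (All F)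
  have "truth_val (a # e') (ren (case_nat 0 (\<lambda>i. Suc (r i))) F) = truth_val (a # e) F" for a
    using All.prems by (intro All.IH[of "Suc n"]) (auto split: nat.splits)
  then show ?case by simp
next
  case (Imp F G)
  have "truth_val e' (ren r F) = truth_val e F" "truth_val e' (ren r G) = truth_val e G"
    by (rule Imp.IH[of n]; use Imp.prems in simp)+
  then show ?case by simp
qed (auto simp: trm_val_ren)

lemma ren_trm_id: "ren_trm (\<lambda>i. i) t = t"
  by (induction t) (auto simp: map_idI)

lemma ren_id: "ren (\<lambda>i. i) F = F"
proof (induction F)
  case (All F)
  have "case_nat 0 Suc = (\<lambda>i. i)" by (auto simp: fun_eq_iff split: nat.splits)
  then show ?case using All by simp
qed (auto simp: ren_trm_id)

text \<open>Weakening is the identity renaming, read between an environment and its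
  extension.\<close>

lemma truth_val_append: "wf_fm (length e) F \<Longrightarrow> truth_val (e @ e') F = truth_val e F"
  using truth_val_ren[of "length e" F "e @ e'" "\<lambda>i. i" e] by (simp add: ren_id nth_append)

text \<open>The outermost quantifier is instantiated first and therefore ends up last in the list of
  values, so the induction splits \<open>es\<close> at its end.\<close>

lemma truth_val_All_funpow:
  "truth_val e ((All ^^ n) F) = (\<Union>es\<in>{es. length es = n}. truth_val (es @ e) F)"
proof (induction n arbitrary: e)
  case (Suc n)
  have "truth_val e ((All ^^ Suc n) F) = (\<Union>a. \<Union>es\<in>{es. length es = n}. truth_val (es @ a # e) F)"
    using Suc by simp
  also have "\<dots> = (\<Union>es\<in>{es. length es = Suc n}. truth_val (es @ e) F)"
  proof (intro set_eqI iffI)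
    fix \<pi> assume "\<pi> \<in> (\<Union>a. \<Union>es\<in>{es. length es = n}. truth_val (es @ a # e) F)"
    then obtain a es where "length es = n" "\<pi> \<in> truth_val (es @ a # e) F" by blast
    then show "\<pi> \<in> (\<Union>es\<in>{es. length es = Suc n}. truth_val (es @ e) F)"
      by (intro UN_I[of "es @ [a]"]) auto
  next
    fix \<pi> assume "\<pi> \<in> (\<Union>es\<in>{es. length es = Suc n}. truth_val (es @ e) F)"
    then obtain es where "length es = Suc n" "\<pi> \<in> truth_val (es @ e) F" by blast
    then show "\<pi> \<in> (\<Union>a. \<Union>es\<in>{es. length es = n}. truth_val (es @ a # e) F)"
      by (cases es rule: rev_cases) auto
  qed
  finally show ?case .
qed simp

section \<open>From well-foundedness to induction\<close>

lemma truth_val_well_founded_fm: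
  assumes "wf_fm 2 P"
  shows "truth_val [] (well_founded_fm P) =
    (\<Union>X. imp_val (\<Union>x. imp_val
        (\<Union>y. imp_val (truth_val [y, x] P) {\<pi>. \<pi> \<in>\<^sub>M stacks A \<and> pair_mem y \<pi> X})
        {\<pi>. \<pi> \<in>\<^sub>M stacks A \<and> pair_mem x \<pi> X})
      (\<Union>x. {\<pi>. \<pi> \<in>\<^sub>M stacks A \<and> pair_mem x \<pi> X}))"
proof -
  \<comment> \<open>The set variable \<open>X\<close> lies behind \<open>y\<close> and
    \<open>x\<close> in the environment, out of reach of \<open>P\<close>.\<close>
  have "truth_val [y, x, X] P = truth_val [y, x] P" for x y X
    using truth_val_append[of "[y, x]" P "[X]"] assms by (simp add: numeral_2_eq_2)
  then show ?thesis by (simp add: well_founded_fm_def)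
qed

lemma truth_val_induction_fm:
  assumes "wf_fm 2 P" "wf_fm (Suc (length zs)) F"
  shows "truth_val zs (induction_fm P F) =
    imp_val (\<Union>x. imp_val (\<Union>y. imp_val (truth_val [y, x] P) (truth_val (y # zs) F))
        (truth_val (x # zs) F))
      (\<Union>x. truth_val (x # zs) F)"
proof -
  have "truth_val (y # x # zs) (ren (case_nat 0 (\<lambda>j. Suc (Suc j))) F) = truth_val (y # zs) F" for x y
    using assms(2) by (intro truth_val_ren[of "Suc (length zs)"]) (auto split: nat.splits)
  moreover have "truth_val (y # x # zs) P = truth_val [y, x] P" for x y
    using truth_val_append[of "[y, x]" P zs] assms(1) by (simp add: numeral_2_eq_2)
  ultimately show ?thesis by (simp add: induction_fm_def)
qed

text \<open>As \<open>orth\<close> is antitone, an inclusion of truth values carries realizers over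
  unchanged. It is proved stack by stack, so the set instantiating \<open>X\<close> may depend on
  \<rho> through \<open>a\<close>.\<close>

lemma truth_val_induction_fm_subset:
  assumes P: "wf_fm 2 P" and F: "wf_fm (Suc (length zs)) F"
  shows "truth_val zs (induction_fm P F) \<subseteq> truth_val [] (well_founded_fm P)"
proof
  fix \<rho> assume "\<rho> \<in> truth_val zs (induction_fm P F)"
  then obtain \<xi> \<pi> a where \<rho>: "\<rho> = push A \<xi> \<pi>" and \<pi>: "\<pi> \<in> truth_val (a # zs) F"
    and \<xi>: "\<xi> \<in> orth (\<Union>x. imp_val (\<Union>y. imp_val (truth_val [y, x] P) (truth_val (y # zs) F))
        (truth_val (x # zs) F))"
    unfolding truth_val_induction_fm[OF P F] imp_val_def[of _ "\<Union>x. truth_val (x # zs) F"] by blast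
  \<comment> \<open>\<open>?W x p y\<close> says that the stack \<open>p\<close> of \<forall>y (y
    \<prec> x \<rightarrow> F[y]) comes from the instance \<open>y\<close>.\<close>
  let ?W = "\<lambda>x p y. p \<in> imp_val (truth_val [y, x] P) (truth_val (y # zs) F)"
  have fo_P: "fo_rel (\<lambda>e. f e \<in> truth_val [g e, h e] P)" if "fo_arg f" "fo_arg g" "fo_arg h" for f g h
    using fo_truth_val[of "[g, h]" P f] that P by (simp add: numeral_2_eq_2)
  have fo_F: "fo_rel (\<lambda>e. f e \<in> truth_val (g e # zs) F)" if "fo_arg f" "fo_arg g" for f g
    using fo_truth_val_params[of "[g]" zs F f] that F by simp
  have fo_W: "fo_rel (\<lambda>e. ?W (f e) (g e) (h e))" if "fo_arg f" "fo_arg g" "fo_arg h" for f g h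
  proof (intro fo_imp_val_mem stack_set_truth_val that(2))
    show "fo_set (\<lambda>e. truth_val [h e, f e] P)" "fo_set (\<lambda>e. truth_val (h e # zs) F)"
      unfolding fo_set_def by (intro allI impI fo_P fo_F fo_arg_funpow_tl that; assumption)+
  qed
  obtain T where T: "a \<in>\<^sub>M T"
    "\<And>x p y. x \<in>\<^sub>M T \<Longrightarrow> p \<in>\<^sub>M stacks A \<Longrightarrow> ?W x p y \<Longrightarrow> \<exists>y. y \<in>\<^sub>M T \<and> ?W x p y"
    using witness_closed_set_exists[of ?W, OF fo_W] by blast
  let ?R = "\<lambda>x z. \<exists>\<pi>. \<pi> \<in>\<^sub>M stacks A \<and> is_pair z x \<pi> \<and> \<pi> \<in> truth_val (x # zs) F"
  have R: "fo_rel (\<lambda>e. ?R (f e) (g e))" if "fo_arg f" "fo_arg g" for f g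
    by (intro fo_logic fo_pair fo_F fo_args that)
  \<comment> \<open>For fixed \<open>x\<close> the required pairs form a set because \<pi> ranges
    over \<open>stacks A\<close>; a second bounded union, over \<open>T\<close>, collects them into
    \<open>X\<close>.\<close>
  obtain X where X: "\<forall>z. z \<in>\<^sub>M X \<longleftrightarrow> (\<exists>x. x \<in>\<^sub>M T \<and> ?R x z)"
  proof -
    have "\<exists>b. \<forall>z. z \<in>\<^sub>M b \<longleftrightarrow> ?R x z" for x
    proof (rule bounded_union)
      show "fo_rel (\<lambda>e. is_pair (g e) x (f e) \<and> f e \<in> truth_val (x # zs) F)"
        if "fo_arg f" "fo_arg g" for f g
        by (intro fo_logic fo_pair fo_F fo_args that)
      show "\<exists>b. \<forall>z. z \<in>\<^sub>M b \<longleftrightarrow> is_pair z x \<pi> \<and> \<pi> \<in> truth_val (x # zs) F" for \<pi>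
      proof (cases "\<pi> \<in> truth_val (x # zs) F")
        case True
        obtain p where "is_pair p x \<pi>" using pair_exists by blast
        then have "is_pair z x \<pi> \<longleftrightarrow> z = p \<or> z = p" for z using pair_unique by blast
        then show ?thesis using True pairing[of p p] by simp
      next
        case False
        then show ?thesis using empty_exists unfolding is_empty_def by blast
      qed
    qed
    from bounded_union[of ?R T, OF R this] show ?thesis using that by blast
  qed
  have X_val: "{\<pi>. \<pi> \<in>\<^sub>M stacks A \<and> pair_mem x \<pi> X} = (if x \<in>\<^sub>M T then truth_val (x # zs) F else {})"
    for x
  proof -
    have "pair_mem x \<pi> X \<longleftrightarrow> x \<in>\<^sub>M T \<and> \<pi> \<in>\<^sub>M stacks A \<and> \<pi> \<in> truth_val (x # zs) F" for \<pi>
    proof -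
      obtain p where "is_pair p x \<pi>" using pair_exists by blast
      then show ?thesis using X pair_mem_iff pair_inject by metis
    qed
    then show ?thesis using stack_set_truth_val unfolding stack_set_def by auto
  qed
  define V where "V x = {\<pi>. \<pi> \<in>\<^sub>M stacks A \<and> pair_mem x \<pi> X}" for x
  have V_in: "V x = truth_val (x # zs) F" if "x \<in>\<^sub>M T" for x
    using X_val that unfolding V_def by simp
  have V_out: "V x = {}" if "\<not> x \<in>\<^sub>M T" for x
    using X_val that unfolding V_def by simp
  \<comment> \<open>This union stands to the left of an implication, so restricting \<open>y\<close>
    to \<open>T\<close> must lose no stack. The closure of \<open>T\<close> replaces each
    \<open>y\<close> by some \<open>y'\<close> in \<open>T\<close> with the same stack
    \<open>p\<close>.\<close>
  have hyp: "(\<Union>y. imp_val (truth_val [y, x] P) (V y)) =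
      (\<Union>y. imp_val (truth_val [y, x] P) (truth_val (y # zs) F))" if x: "x \<in>\<^sub>M T" for x
  proof (intro set_eqI iffI)
    fix p assume "p \<in> (\<Union>y. imp_val (truth_val [y, x] P) (V y))"
    then obtain y where y: "p \<in> imp_val (truth_val [y, x] P) (V y)" by blast
    \<comment> \<open>An implication whose conclusion has an empty truth value has no
      stacks.\<close>
    then have "y \<in>\<^sub>M T" using V_out unfolding imp_val_def by blast
    then show "p \<in> (\<Union>y. imp_val (truth_val [y, x] P) (truth_val (y # zs) F))"
      using y V_in by auto
  next
    fix p assume "p \<in> (\<Union>y. imp_val (truth_val [y, x] P) (truth_val (y # zs) F))"
    then obtain y where y: "?W x p y" by blast
    then have "p \<in>\<^sub>M stacks A"
      using stack_set_imp_val[OF stack_set_truth_val] unfolding stack_set_def by blast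
    then obtain y' where y': "y' \<in>\<^sub>M T" "?W x p y'" using T(2) x y by blast
    then have "p \<in> imp_val (truth_val [y', x] P) (V y')" using V_in by simp
    then show "p \<in> (\<Union>y. imp_val (truth_val [y, x] P) (V y))" by blast
  qed
  have "(\<Union>x. imp_val (\<Union>y. imp_val (truth_val [y, x] P) (V y)) (V x)) \<subseteq>
      (\<Union>x. imp_val (\<Union>y. imp_val (truth_val [y, x] P) (truth_val (y # zs) F)) (truth_val (x # zs) F))"
  proof
    fix p assume "p \<in> (\<Union>x. imp_val (\<Union>y. imp_val (truth_val [y, x] P) (V y)) (V x))"
    then obtain x where x: "p \<in> imp_val (\<Union>y. imp_val (truth_val [y, x] P) (V y)) (V x)" by blast
    then have "x \<in>\<^sub>M T" using V_out unfolding imp_val_def by blast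
    then show "p \<in> (\<Union>x. imp_val (\<Union>y. imp_val (truth_val [y, x] P) (truth_val (y # zs) F))
        (truth_val (x # zs) F))"
      using x hyp V_in by auto
  qed
  then have "\<xi> \<in> orth (\<Union>x. imp_val (\<Union>y. imp_val (truth_val [y, x] P) (V y)) (V x))"
    using \<xi> unfolding orth_def by blast
  moreover have "\<pi> \<in> (\<Union>x. V x)" using \<pi> T(1) V_in by blast
  ultimately have "\<rho> \<in> imp_val (\<Union>x. imp_val (\<Union>y. imp_val (truth_val [y, x] P) (V y)) (V x)) (\<Union>x. V x)"
    using \<rho> unfolding imp_val_def[of _ "\<Union>x. V x"] by blast
  then show "\<rho> \<in> truth_val [] (well_founded_fm P)"
    unfolding truth_val_well_founded_fm[OF P] V_def by blast
qed

end

theorem theorem6: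
  fixes E :: "'m \<Rightarrow> 'm \<Rightarrow> bool"
    and A :: "'m realizability_algebra"
    and P F :: "'m fm"
    and n :: nat
  assumes "realizability_model E A"
    and "membership.wf_fm E 2 P"
    and "realizability_model.holds E A (well_founded_fm P)"
    and "membership.wf_fm E (Suc n) F"
  shows "realizability_model.holds E A ((All ^^ n) (induction_fm P F))"
proof -
  interpret realizability_model E A by fact
  have "truth_val [] ((All ^^ n) (induction_fm P F)) \<subseteq> truth_val [] (well_founded_fm P)"
    using truth_val_induction_fm_subset[OF assms(2)] assms(4)
    unfolding truth_val_All_funpow by auto
  \<comment> \<open>The inclusion reverses under \<open>orth\<close>, so the proof-like term
    realizing well-foundedness also realizes the closed induction formula.\<close>
  then show ?thesis
    using assms(3) unfolding holds_def realizes_def orth_def by blast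
qed

end
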